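(* Let $\mathfrak{N}_1$ be the $3$-dimensional complex Zinbiel algebra with basis $e_1,e_2,e_3$ and multiplication $e_1e_2=e_3$, $e_2e_1=-e_3$ (all other products of basis elements are zero). Let $[\mathfrak{N}_1]^i$ be an $i$-dimensional non-trivial central extension of $\mathfrak{N}_1$. Then $[\mathfrak{N}_1]^i$ is isomorphic to one algebra from the following list, where each algebra has basis $e_1,\dots,e_{3+i}$ and only the nonzero products of basis elements are written. (1) If $i=1$: - $[\mathfrak{N}_1]^1_{01}$: $e_1e_2=e_3,\ e_1e_3=e_4,\ e_2e_1=-e_3,\ e_2e_2=e_4$; - $[\mathfrak{N}_1]^1_{02}$: $e_1e_2=e_3,\ e_1e_3=e_4,\ e_2e_1=-e_3$. (2) If $i=2$: - $[\mathfrak{N}_1]^2_{01}$: $e_1e_1=e_4,\ e_1e_2=e_3,\ e_1e_3=e_5,\ e_2e_1=-e_3$; - $[\mathfrak{N}_1]^2_{02}$: $e_1e_2=e_3+e_4,\ e_1e_3=e_5,\ e_2e_1=-e_3$; - $[\mathfrak{N}_1]^2_{03}$: $e_1e_2=e_3,\ e_2e_1=-e_3,\ e_1e_3=e_5,\ e_2e_2=e_4$; - $[\mathfrak{N}_1]^2_{04}$: $e_1e_1=e_4,\ e_1e_2=e_3,\ e_1e_3=e_5,\ e_2e_1=-e_3,\ e_2e_2=e_4$; - $[\mathfrak{N}_1]^2_{05}$: $e_1e_2=e_3,\ e_1e_3=e_5,\ e_2e_1=-e_3,\ e_2e_3=e_4$; - $[\mathfrak{N}_1]^2_{06}$: $e_1e_1=e_4,\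 e_1e_2=e_3,\ e_1e_3=e_5,\ e_2e_1=-e_3,\ e_2e_3=e_4$; - $[\mathfrak{N}_1]^2_{07}$: $e_1e_2=e_3+e_4,\ e_1e_3=e_5,\ e_2e_1=-e_3,\ e_2e_3=e_4$; - $[\mathfrak{N}_1]^2_{08}$: $e_1e_1=e_4,\ e_1e_2=e_3,\ e_1e_3=e_5,\ e_2e_1=-e_3,\ e_2e_2=e_4,\ e_2e_3=e_4$; - $[\mathfrak{N}_1]^2_{09}$: $e_1e_1=e_4,\ e_1e_2=e_3,\ e_1e_3=e_5,\ e_2e_1=-e_3,\ e_2e_2=e_5$; - $[\mathfrak{N}_1]^2_{10}$: $e_1e_2=e_3+e_4,\ e_1e_3=e_5,\ e_2e_1=-e_3,\ e_2e_2=e_5$. (3) If $i=3$: - $[\mathfrak{N}_1]^3_{01}$: $e_1e_1=e_5,\ e_1e_2=e_3+e_4,\ e_1e_3=e_6,\ e_2e_1=-e_3$; - $[\mathfrak{N}_1]^3_{02}$: $e_1e_1=e_5,\ e_1e_2=e_3,\ e_1e_3=e_6,\ e_2e_1=-e_3,\ e_2e_2=e_4$; - $[\mathfrak{N}_1]^3_{03}$: $e_1e_1=e_5,\ e_1e_2=e_3,\ e_1e_3=e_6,\ e_2e_1=-e_3,\ e_2e_3=e_4$; - $[\mathfrak{N}_1]^3_{04}$: $e_1e_1=e_5,\ e_1e_2=e_3,\ e_1e_3=e_6,\ e_2e_1=-e_3,\ e_2e_2=e_4,\ e_2e_3=e_4$; - $[\mathfrak{N}_1]^3_{05}$: $e_1e_2=e_3+e_5,\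 e_1e_3=e_6,\ e_2e_1=-e_3,\ e_2e_2=e_4$; - $[\mathfrak{N}_1]^3_{06}$: $e_1e_1=e_4,\ e_1e_2=e_3+e_5,\ e_1e_3=e_6,\ e_2e_1=-e_3,\ e_2e_2=e_4$; - $[\mathfrak{N}_1]^3_{07}$: $e_1e_2=e_3+e_5,\ e_1e_3=e_6,\ e_2e_1=-e_3,\ e_2e_3=e_4$; - $[\mathfrak{N}_1]^3_{08}$: $e_1e_1=e_4,\ e_1e_2=e_3+e_5,\ e_1e_3=e_6,\ e_2e_1=-e_3,\ e_2e_3=e_4$; - $[\mathfrak{N}_1]^3_{09}$: $e_1e_1=e_4,\ e_1e_2=e_3,\ e_1e_3=e_6,\ e_2e_1=-e_3,\ e_2e_2=e_5,\ e_2e_3=e_4$; - $[\mathfrak{N}_1]^3_{10}$: $e_1e_1=e_4+e_5,\ e_1e_2=e_3,\ e_1e_3=e_6,\ e_2e_1=-e_3,\ e_2e_2=e_5,\ e_2e_3=e_4$; - $[\mathfrak{N}_1]^3_{11}$: $e_1e_1=e_5,\ e_1e_2=e_3+e_4,\ e_1e_3=e_6,\ e_2e_1=-e_3,\ e_2e_2=e_6$. (4) If $i=4$: - $[\mathfrak{N}_1]^4_{01}$: $e_1e_1=e_6,\ e_1e_2=e_3+e_5,\ e_1e_3=e_7,\ e_2e_1=-e_3,\ e_2e_2=e_4$; - $[\mathfrak{N}_1]^4_{02}$: $e_1e_1=e_6,\ e_1e_2=e_3+e_5,\ e_1e_3=e_7,\ e_2e_1=-e_3,\ e_2e_3=e_4$;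 - $[\mathfrak{N}_1]^4_{03}$: $e_1e_1=e_6,\ e_1e_2=e_3,\ e_1e_3=e_7,\ e_2e_1=-e_3,\ e_2e_2=e_5,\ e_2e_3=e_4$; - $[\mathfrak{N}_1]^4_{04}$: $e_1e_1=e_4,\ e_1e_2=e_3+e_6,\ e_1e_3=e_7,\ e_2e_1=-e_3,\ e_2e_2=e_5,\ e_2e_3=e_4$. (5) If $i=5$: - $[\mathfrak{N}_1]^5_{01}$: $e_1e_1=e_4,\ e_1e_2=e_3+e_5,\ e_1e_3=e_7,\ e_2e_1=-e_3,\ e_2e_2=e_6,\ e_2e_3=e_8$.
   Context: All algebras and vector spaces are over $\mathbb{C}$ and finite-dimensional. A Zinbiel algebra is a (not necessarily associative) algebra satisfying $(xy)z=x(yz+zy)$. The annihilator of an algebra $\mathbf{A}$ is $\mathrm{Ann}(\mathbf{A})=\{x\in\mathbf{A}: x\mathbf{A}+\mathbf{A}x=0\}$. For a Zinbiel algebra $\mathbf{A}$ and a vector space $\mathbb{V}$, $\mathrm{Z}^2(\mathbf{A},\mathbb{V})$ is the space of bilinear maps $\theta:\mathbf{A}\times\mathbf{A}\to\mathbb{V}$ with $\theta(xy,z)=\theta(x,yz+zy)$ for all $x,y,z\in\mathbf{A}$ (cocycles). For $\theta\in\mathrm{Z}^2(\mathbf{A},\mathbb{V})$, the algebra $\mathbf{A}_\theta=\mathbf{A}\oplus\mathbb{V}$ with product $[x+x',y+y']=xy+\theta(x,y)$ ($x,y\in\mathbf{A}$, $x',y'\in\mathbb{V}$) is a Zinbiel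 algebra, called a ($\dim\mathbb{V}$)-dimensional central extension of $\mathbf{A}$ by $\mathbb{V}$. A nonzero subspace $I\subseteq\mathrm{Ann}(\mathbf{B})$ is an annihilator component of an algebra $\mathbf{B}$ if $\mathbf{B}=\mathbf{B}_0\oplus I$ as a direct sum of algebras (ideals). A central extension without annihilator component is called non-split. An $i$-dimensional central extension ($i\ge 1$) of a $3$-dimensional algebra $\mathbf{A}$ is called non-trivial if it is non-split and cannot be considered as a central extension of an algebra of dimension smaller than $\dim\mathbf{A}=3$ (equivalently, non-split with annihilator of dimension exactly $i$, i.e. $\mathrm{Ann}(\mathbf{A}_\theta)=\mathbb{V}$). *)

theory Defs
  imports Complex_Main "HOL-Library.Function_Algebras" "HOL-Library.Product_Plus"
begin

text \<open>
  A complex vector space is a subspace \<open>vecs\<close> of an ambient type with scalar multiplication \<open>scl\<close>;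
  an algebra has in addition a product \<open>prd\<close>, of which only the values on \<open>vecs\<close> matter.
  The carrier makes it possible to quantify over spaces of all finite dimensions inside one type.
\<close>

record 'a cspace =
  vecs :: "'a set"
  scl :: "complex \<Rightarrow> 'a \<Rightarrow> 'a"

record 'a calg = "'a cspace" +
  prd :: "'a \<Rightarrow> 'a \<Rightarrow> 'a"

definition subspace_of :: "'a::ab_group_add set \<Rightarrow> ('a, 'z) cspace_scheme \<Rightarrow> bool" where
  "subspace_of S V \<longleftrightarrow> module.subspace (scl V) S \<and> S \<subseteq> vecs V"

definition fd_space :: "('a::ab_group_add, 'z) cspace_scheme \<Rightarrow> bool" where
  "fd_space V \<longleftrightarrow> vector_space (scl V) \<and> module.subspace (scl V) (vecs V) \<and>
     (\<exists>B. finite B \<and> module.span (scl V) B = vecs V)"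

definition cdim :: "('a::ab_group_add, 'z) cspace_scheme \<Rightarrow> nat" where
  "cdim V = vector_space.dim (scl V) (vecs V)"

definition linear_map ::
  "('a::ab_group_add, 'y) cspace_scheme \<Rightarrow> ('b::ab_group_add, 'z) cspace_scheme \<Rightarrow> ('a \<Rightarrow> 'b) \<Rightarrow> bool"
  where
  "linear_map V W f \<longleftrightarrow> (\<forall>x\<in>vecs V. f x \<in> vecs W) \<and>
     (\<forall>x\<in>vecs V. \<forall>y\<in>vecs V. f (x + y) = f x + f y) \<and>
     (\<forall>c. \<forall>x\<in>vecs V. f (scl V c x) = scl W c (f x))"

definition bilinear_map ::
  "('a::ab_group_add, 'y) cspace_scheme \<Rightarrow> ('b::ab_group_add, 'z) cspace_scheme \<Rightarrow> ('a \<Rightarrow> 'a \<Rightarrow> 'b) \<Rightarrow> bool"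
  where
  "bilinear_map V W \<theta> \<longleftrightarrow>
     (\<forall>x\<in>vecs V. linear_map V W (\<lambda>y. \<theta> x y)) \<and> (\<forall>y\<in>vecs V. linear_map V W (\<lambda>x. \<theta> x y))"

definition fd_algebra :: "'a::ab_group_add calg \<Rightarrow> bool" where
  "fd_algebra A \<longleftrightarrow> fd_space A \<and> bilinear_map A A (prd A)"

definition zinbiel :: "'a::ab_group_add calg \<Rightarrow> bool" where
  "zinbiel A \<longleftrightarrow> fd_algebra A \<and>
     (\<forall>x\<in>vecs A. \<forall>y\<in>vecs A. \<forall>z\<in>vecs A. prd A (prd A x y) z = prd A x (prd A y z + prd A z y))"

definition isomorphic_alg :: "'a::ab_group_add calg \<Rightarrow> 'b::ab_group_add calg \<Rightarrow> bool" where
  "isomorphic_alg A B \<longleftrightarrow> (\<exists>f. linear_map A B f \<and> bij_betw f (vecs A) (vecs B) \<and>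
     (\<forall>x\<in>vecs A. \<forall>y\<in>vecs A. f (prd A x y) = prd B (f x) (f y)))"

definition Ann :: "'a::ab_group_add calg \<Rightarrow> 'a set" where
  "Ann A = {x \<in> vecs A. \<forall>y\<in>vecs A. prd A x y = 0 \<and> prd A y x = 0}"

definition ideal_of :: "'a::ab_group_add set \<Rightarrow> 'a calg \<Rightarrow> bool" where
  "ideal_of I A \<longleftrightarrow> subspace_of I A \<and> (\<forall>x\<in>I. \<forall>y\<in>vecs A. prd A x y \<in> I \<and> prd A y x \<in> I)"

definition annihilator_component :: "'a::ab_group_add set \<Rightarrow> 'a calg \<Rightarrow> bool" where
  "annihilator_component I B \<longleftrightarrow> subspace_of I B \<and> I \<noteq> {0} \<and> I \<subseteq> Ann B \<and>
     (\<exists>B0. ideal_of B0 B \<and> ideal_of I B \<and> B0 \<inter> I = {0} \<and> vecs B = {x + y | x y. x \<in> B0 \<and> y \<in> I})"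

definition cocycles ::
  "'a::ab_group_add calg \<Rightarrow> 'v::ab_group_add cspace \<Rightarrow> ('a \<Rightarrow> 'a \<Rightarrow> 'v) set" where
  "cocycles A V = {\<theta>. bilinear_map A V \<theta> \<and>
     (\<forall>x\<in>vecs A. \<forall>y\<in>vecs A. \<forall>z\<in>vecs A. \<theta> (prd A x y) z = \<theta> x (prd A y z + prd A z y))}"

definition central_ext ::
  "'a::ab_group_add calg \<Rightarrow> 'v::ab_group_add cspace \<Rightarrow> ('a \<Rightarrow> 'a \<Rightarrow> 'v) \<Rightarrow> ('a \<times> 'v) calg" where
  "central_ext A V \<theta> =
     \<lparr>vecs = vecs A \<times> vecs V,
      scl = (\<lambda>c (x, x'). (scl A c x, scl V c x')),
      prd = (\<lambda>(x, x') (y, y'). (prd A x y, \<theta> x y))\<rparr>"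

definition non_split :: "'a::ab_group_add calg \<Rightarrow> bool" where
  "non_split B \<longleftrightarrow> \<not> (\<exists>I. annihilator_component I B)"

text \<open>
  Every finite-dimensional complex space is isomorphic to one inside \<^typ>\<open>nat \<Rightarrow> complex\<close>, so
  letting \<open>A\<close> and \<open>V\<close> below range over spaces in this type is no restriction.
\<close>

definition central_ext_of_dim_less :: "nat \<Rightarrow> 'a::ab_group_add calg \<Rightarrow> bool" where
  "central_ext_of_dim_less n B \<longleftrightarrow>
     (\<exists>(A :: (nat \<Rightarrow> complex) calg) (V :: (nat \<Rightarrow> complex) cspace) \<theta>.
        zinbiel A \<and> fd_space V \<and> \<theta> \<in> cocycles A V \<and> cdim A < n \<and>
        isomorphic_alg B (central_ext A V \<theta>))"

definition nontrivial_ext ::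
  "'a::ab_group_add calg \<Rightarrow> 'v::ab_group_add cspace \<Rightarrow> ('a \<Rightarrow> 'a \<Rightarrow> 'v) \<Rightarrow> bool" where
  "nontrivial_ext A V \<theta> \<longleftrightarrow> non_split (central_ext A V \<theta>) \<and>
     \<not> central_ext_of_dim_less (cdim A) (central_ext A V \<theta>)"

definition e :: "nat \<Rightarrow> nat \<Rightarrow> complex" where
  "e k = (\<lambda>m. if m = k then 1 else 0)"

text \<open>
  The algebra with basis \<open>e 1, \<dots>, e n\<close> in which \<open>e j e k = v\<close> for each entry \<open>(j, k, v)\<close>
  of the table \<open>T\<close>, products of basis elements without an entry being zero.
\<close>

definition table_alg :: "nat \<Rightarrow> (nat \<times> nat \<times> (nat \<Rightarrow> complex)) list \<Rightarrow> (nat \<Rightarrow> complex) calg" where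
  "table_alg n T =
     \<lparr>vecs = {x. \<forall>m. m \<notin> {1..n} \<longrightarrow> x m = 0},
      scl = (\<lambda>c x m. c * x m),
      prd = (\<lambda>x y m. \<Sum>(j, k, v)\<leftarrow>T. x j * y k * v m)\<rparr>"

definition N1 :: "(nat \<Rightarrow> complex) calg" where
  "N1 = table_alg 3 [(1,2,e 3), (2,1,- e 3)]"

definition N1_tables_1 :: "(nat \<times> nat \<times> (nat \<Rightarrow> complex)) list set" where
  "N1_tables_1 =
    {[(1,2,e 3), (1,3,e 4), (2,1,- e 3), (2,2,e 4)],
     [(1,2,e 3), (1,3,e 4), (2,1,- e 3)]}"

definition N1_tables_2 :: "(nat \<times> nat \<times> (nat \<Rightarrow> complex)) list set" where
  "N1_tables_2 =
    {[(1,1,e 4), (1,2,e 3), (1,3,e 5), (2,1,- e 3)],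
     [(1,2,e 3 + e 4), (1,3,e 5), (2,1,- e 3)],
     [(1,2,e 3), (2,1,- e 3), (1,3,e 5), (2,2,e 4)],
     [(1,1,e 4), (1,2,e 3), (1,3,e 5), (2,1,- e 3), (2,2,e 4)],
     [(1,2,e 3), (1,3,e 5), (2,1,- e 3), (2,3,e 4)],
     [(1,1,e 4), (1,2,e 3), (1,3,e 5), (2,1,- e 3), (2,3,e 4)],
     [(1,2,e 3 + e 4), (1,3,e 5), (2,1,- e 3), (2,3,e 4)],
     [(1,1,e 4), (1,2,e 3), (1,3,e 5), (2,1,- e 3), (2,2,e 4), (2,3,e 4)],
     [(1,1,e 4), (1,2,e 3), (1,3,e 5), (2,1,- e 3), (2,2,e 5)],
     [(1,2,e 3 + e 4), (1,3,e 5), (2,1,- e 3), (2,2,e 5)]}"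

definition N1_tables_3 :: "(nat \<times> nat \<times> (nat \<Rightarrow> complex)) list set" where
  "N1_tables_3 =
    {[(1,1,e 5), (1,2,e 3 + e 4), (1,3,e 6), (2,1,- e 3)],
     [(1,1,e 5), (1,2,e 3), (1,3,e 6), (2,1,- e 3), (2,2,e 4)],
     [(1,1,e 5), (1,2,e 3), (1,3,e 6), (2,1,- e 3), (2,3,e 4)],
     [(1,1,e 5), (1,2,e 3), (1,3,e 6), (2,1,- e 3), (2,2,e 4), (2,3,e 4)],
     [(1,2,e 3 + e 5), (1,3,e 6), (2,1,- e 3), (2,2,e 4)],
     [(1,1,e 4), (1,2,e 3 + e 5), (1,3,e 6), (2,1,- e 3), (2,2,e 4)],
     [(1,2,e 3 + e 5), (1,3,e 6), (2,1,- e 3), (2,3,e 4)],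
     [(1,1,e 4), (1,2,e 3 + e 5), (1,3,e 6), (2,1,- e 3), (2,3,e 4)],
     [(1,1,e 4), (1,2,e 3), (1,3,e 6), (2,1,- e 3), (2,2,e 5), (2,3,e 4)],
     [(1,1,e 4 + e 5), (1,2,e 3), (1,3,e 6), (2,1,- e 3), (2,2,e 5), (2,3,e 4)],
     [(1,1,e 5), (1,2,e 3 + e 4), (1,3,e 6), (2,1,- e 3), (2,2,e 6)]}"

definition N1_tables_4 :: "(nat \<times> nat \<times> (nat \<Rightarrow> complex)) list set" where
  "N1_tables_4 =
    {[(1,1,e 6), (1,2,e 3 + e 5), (1,3,e 7), (2,1,- e 3), (2,2,e 4)],
     [(1,1,e 6), (1,2,e 3 + e 5), (1,3,e 7), (2,1,- e 3), (2,3,e 4)],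
     [(1,1,e 6), (1,2,e 3), (1,3,e 7), (2,1,- e 3), (2,2,e 5), (2,3,e 4)],
     [(1,1,e 4), (1,2,e 3 + e 6), (1,3,e 7), (2,1,- e 3), (2,2,e 5), (2,3,e 4)]}"

definition N1_tables_5 :: "(nat \<times> nat \<times> (nat \<Rightarrow> complex)) list set" where
  "N1_tables_5 =
    {[(1,1,e 4), (1,2,e 3 + e 5), (1,3,e 7), (2,1,- e 3), (2,2,e 6), (2,3,e 8)]}"

end

theory Submission
  imports Defs "HOL-Computational_Algebra.Fundamental_Theorem_Algebra"
begin

text \<open>
  In \<open>N1\<close> the vector \<open>e\<^sub>3\<close> is the product \<open>e\<^sub>1 e\<^sub>2\<close> and the multiplication is anticommutative, so the
  cocycle identity forces \<open>\<theta>(e\<^sub>3, \<cdot>) = 0\<close>. Up to a change of the complement of \<open>V\<close> in the extension,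
  \<open>\<theta>\<close> therefore consists of five vectors of \<open>V\<close>: the coefficients \<open>q\<^sub>1\<^sub>1, q\<^sub>1\<^sub>2, q\<^sub>2\<^sub>2\<close> of the \<open>V\<close>-valued
  binary quadratic form \<open>q(x) = \<theta>(x, x)\<close> on the span of \<open>e\<^sub>1, e\<^sub>2\<close>, and the coefficients \<open>l\<^sub>1, l\<^sub>2\<close> of the
  linear form \<open>l(x) = \<theta>(x, e\<^sub>3)\<close>. The extension is non-split only if these five vectors span \<open>V\<close>
  (\<open>non_split_spans\<close>), because a functional that kills all of them turns \<open>\<theta>\<close> into a coboundary and
  thereby splits off a line. If \<open>l = 0\<close>, then \<open>e\<^sub>3\<close> gives one more dimension of the annihilator and the
  algebra already extends a two-dimensional one (\<open>linear_part_nonzero\<close>). So the theorem is a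
  classification of pairs \<open>(q, l)\<close> with \<open>l \<noteq> 0\<close>.

  Another pair of generators of \<open>N1\<close> changes \<open>(q, l)\<close> by a linear substitution, in which \<open>l\<close> is also
  multiplied by the determinant; adding multiples of \<open>e\<^sub>3\<close> to the generators adds to \<open>q\<close> the product
  of \<open>l\<close> and a scalar linear form. The relation \<open>attained\<close> collects all resulting quintuples, and
  \<open>classification\<close> finds a normal form among them.

  If \<open>l\<close> has rank one, the substitution makes \<open>l\<^sub>2 = 0\<close>; then \<open>q\<^sub>1\<^sub>1\<close> and \<open>q\<^sub>1\<^sub>2\<close> matter only modulo \<open>l\<^sub>1\<close>,
  and completing the square and rescaling suffice (\<open>classified_rank_one\<close>). If \<open>l\<^sub>1, l\<^sub>2\<close> are
  independent, one first normalises \<open>q\<close> modulo their span \<open>L\<close>: the functionals on \<open>V/L\<close> give a space of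
  scalar quadratic forms of dimension \<open>dim V - 2\<close>. What remains is the component of \<open>q\<close> in \<open>L\<close>, and
  it is controlled by the binary cubic \<open>q \<and> l\<close> modulo the products of those quadratic forms with
  linear forms; the wedge is insensitive to adding multiples of \<open>l\<close> to \<open>q\<close>. Up to equivalence there
  are four cubics when \<open>dim V = 2\<close>; three residue classes for a quadratic form of either rank when
  \<open>dim V = 3\<close>; three in all, for the two kinds of pencils of quadratic forms, when \<open>dim V = 4\<close>; and
  only the zero class when \<open>dim V = 5\<close> (\<open>classified_rank_two\<close>).

  A quintuple in normal form is literally the multiplication table of a basis of the extension that
  consists of the new generators \<open>u, v\<close>, the vector \<open>- v u\<close> and a basis of \<open>V\<close> (\<open>isomorphic_table_alg\<close>).
\<close>

section \<open>Linear algebra over the complex numbers\<close>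

locale complex_space = vector_space scale
  for scale :: "complex \<Rightarrow> 'v::ab_group_add \<Rightarrow> 'v" (infixr \<open>*s\<close> 75)
begin

text \<open>
  Comparing coordinates in one fixed basis turns vector equations into ring identities between
  complex numbers, which the simplifier can settle.
\<close>

definition coord :: "'v \<Rightarrow> 'v \<Rightarrow> complex" where
  "coord b x = representation (extend_basis {}) x b"

lemma span_extend_basis_empty: "independent (extend_basis {})" "x \<in> span (extend_basis {})"
  by (simp_all add: independent_extend_basis independent_empty)

lemma coord_simps:
  fixes x y b :: 'v and c :: complex
  shows
  "coord b (x + y) = coord b x + coord b y"
  "coord b (x - y) = coord b x - coord b y"
  "coord b (- x) = - coord b x"
  "coord b (scale c x) = c * coord b x"
  "coord b 0 = 0"
  by (simp_all add: coord_def representation_add representation_diff representation_neg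
      representation_scale representation_zero span_extend_basis_empty)

lemma vec_eqI:
  assumes "\<And>b. coord b x = coord b y"
  shows "x = y"
proof -
  have eq: "representation (extend_basis {}) x = representation (extend_basis {}) y"
    using assms by (auto simp: coord_def)
  have "x = (\<Sum>b | representation (extend_basis {}) x b \<noteq> 0. representation (extend_basis {}) x b *s b)"
    by (rule sum_nonzero_representation_eq[symmetric]) (rule span_extend_basis_empty)+
  also have "\<dots> = (\<Sum>b | representation (extend_basis {}) y b \<noteq> 0. representation (extend_basis {}) y b *s b)"
    by (simp only: eq)
  also have "\<dots> = y"
    by (rule sum_nonzero_representation_eq) (rule span_extend_basis_empty)+
  finally show ?thesis .
qed

lemma spanning_list_is_basis:
  assumes "span (set vs) = V" and "dim V = length vs"
  shows "independent (set vs)" "distinct vs"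
proof -
  obtain B where B: "B \<subseteq> set vs" "independent B" "set vs \<subseteq> span B"
    using maximal_independent_subset by blast
  have "span B = V"
    using B(1,3) assms(1) by (metis span_mono span_span subset_antisym span_minimal subspace_span)
  then have "card B = length vs"
    using B(2) assms(2) dim_span_eq_card_independent by metis
  moreover have "card B \<le> card (set vs)" by (simp add: B(1) card_mono)
  ultimately have *: "card B = card (set vs)" "card (set vs) = length vs"
    using card_length[of vs] by auto
  show "distinct vs" using *(2) by (rule card_distinct)
  show "independent (set vs)"
    using card_subset_eq[OF _ B(1) *(1)] B(2) by simp
qed

end

section \<open>Changes of generators acting on a quadratic and a linear part\<close>

locale quadratic_data = complex_space scale
  for scale :: "complex \<Rightarrow> 'v::ab_group_add \<Rightarrow> 'v" (infixr \<open>*s\<close> 75) +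
  fixes q11 q12 q22 l1 l2 :: 'v
begin

text \<open>
  When \<open>q\<close> and \<open>l\<close> come from a cocycle \<open>\<theta>\<close> of \<open>N1\<close>, these are the quintuples of the generators \<open>u = a e\<^sub>1 + b e\<^sub>2 + s e\<^sub>3\<close> and \<open>v = c e\<^sub>1 + d e\<^sub>2 + t e\<^sub>3\<close>, whose product
  is \<open>(a d - b c) e\<^sub>3\<close>: the first three entries are the coefficients of \<open>\<theta>(x u + y v, x u + y v)\<close>,
  the last two are \<open>\<theta>(u, u v)\<close> and \<open>\<theta>(v, u v)\<close>.
\<close>

definition attained :: "'v \<Rightarrow> 'v \<Rightarrow> 'v \<Rightarrow> 'v \<Rightarrow> 'v \<Rightarrow> bool" where
  "attained p11 p12 p22 m1 m2 \<longleftrightarrow> (\<exists>a b c d s t. a * d - b * c \<noteq> 0 \<and>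
     p11 = a\<^sup>2 *s q11 + (a * b) *s q12 + b\<^sup>2 *s q22 + (s * a) *s l1 + (s * b) *s l2 \<and>
     p12 = (2 * a * c) *s q11 + (a * d + b * c) *s q12 + (2 * b * d) *s q22
           + (t * a + s * c) *s l1 + (t * b + s * d) *s l2 \<and>
     p22 = c\<^sup>2 *s q11 + (c * d) *s q12 + d\<^sup>2 *s q22 + (t * c) *s l1 + (t * d) *s l2 \<and>
     m1 = ((a * d - b * c) * a) *s l1 + ((a * d - b * c) * b) *s l2 \<and>
     m2 = ((a * d - b * c) * c) *s l1 + ((a * d - b * c) * d) *s l2)"

lemma attained_start: "attained q11 q12 q22 l1 l2"
  unfolding attained_def
  by (rule exI[of _ 1], rule exI[of _ 0], rule exI[of _ 0], rule exI[of _ 1], rule exI[of _ 0],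
      rule exI[of _ 0]) simp

text \<open>
  A change of generators followed by another one is again a change of generators. The coefficients
  \<open>s, t\<close> of the second change refer to the product of the current generators, which is why no
  determinant accompanies them.
\<close>

lemma attained_move:
  assumes "attained p11 p12 p22 m1 m2" and "a * d - b * c \<noteq> 0"
    and "r11 = a\<^sup>2 *s p11 + (a * b) *s p12 + b\<^sup>2 *s p22 + (s * a) *s m1 + (s * b) *s m2"
    and "r12 = (2 * a * c) *s p11 + (a * d + b * c) *s p12 + (2 * b * d) *s p22
               + (t * a + s * c) *s m1 + (t * b + s * d) *s m2"
    and "r22 = c\<^sup>2 *s p11 + (c * d) *s p12 + d\<^sup>2 *s p22 + (t * c) *s m1 + (t * d) *s m2"
    and "n1 = ((a * d - b * c) * a) *s m1 + ((a * d - b * c) * b) *s m2"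
    and "n2 = ((a * d - b * c) * c) *s m1 + ((a * d - b * c) * d) *s m2"
  shows "attained r11 r12 r22 n1 n2"
proof -
  obtain a0 b0 c0 d0 s0 t0 where D0: "a0 * d0 - b0 * c0 \<noteq> 0" and p:
     "p11 = a0\<^sup>2 *s q11 + (a0 * b0) *s q12 + b0\<^sup>2 *s q22 + (s0 * a0) *s l1 + (s0 * b0) *s l2"
     "p12 = (2 * a0 * c0) *s q11 + (a0 * d0 + b0 * c0) *s q12 + (2 * b0 * d0) *s q22
           + (t0 * a0 + s0 * c0) *s l1 + (t0 * b0 + s0 * d0) *s l2"
     "p22 = c0\<^sup>2 *s q11 + (c0 * d0) *s q12 + d0\<^sup>2 *s q22 + (t0 * c0) *s l1 + (t0 * d0) *s l2"
     "m1 = ((a0 * d0 - b0 * c0) * a0) *s l1 + ((a0 * d0 - b0 * c0) * b0) *s l2"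
     "m2 = ((a0 * d0 - b0 * c0) * c0) *s l1 + ((a0 * d0 - b0 * c0) * d0) *s l2"
    using assms(1) unfolding attained_def by blast
  let ?D = "a0 * d0 - b0 * c0"
  let ?a = "a * a0 + b * c0" and ?b = "a * b0 + b * d0"
  let ?c = "c * a0 + d * c0" and ?d = "c * b0 + d * d0"
  let ?s = "a * s0 + b * t0 + s * ?D" and ?t = "c * s0 + d * t0 + t * ?D"
  have "?a * ?d - ?b * ?c = (a * d - b * c) * ?D" by algebra
  then have D: "?a * ?d - ?b * ?c \<noteq> 0" using D0 assms(2) by simp
  have "r11 = ?a\<^sup>2 *s q11 + (?a * ?b) *s q12 + ?b\<^sup>2 *s q22 + (?s * ?a) *s l1 + (?s * ?b) *s l2"
    unfolding assms(3) p by (rule vec_eqI, simp add: coord_simps algebra_simps power2_eq_square)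
  moreover have "r12 = (2 * ?a * ?c) *s q11 + (?a * ?d + ?b * ?c) *s q12 + (2 * ?b * ?d) *s q22
           + (?t * ?a + ?s * ?c) *s l1 + (?t * ?b + ?s * ?d) *s l2"
    unfolding assms(4) p by (rule vec_eqI, simp add: coord_simps algebra_simps power2_eq_square)
  moreover have "r22 = ?c\<^sup>2 *s q11 + (?c * ?d) *s q12 + ?d\<^sup>2 *s q22 + (?t * ?c) *s l1 + (?t * ?d) *s l2"
    unfolding assms(5) p by (rule vec_eqI, simp add: coord_simps algebra_simps power2_eq_square)
  moreover have "n1 = ((?a * ?d - ?b * ?c) * ?a) *s l1 + ((?a * ?d - ?b * ?c) * ?b) *s l2"
    unfolding assms(6) p by (rule vec_eqI, simp add: coord_simps algebra_simps power2_eq_square)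
  moreover have "n2 = ((?a * ?d - ?b * ?c) * ?c) *s l1 + ((?a * ?d - ?b * ?c) * ?d) *s l2"
    unfolding assms(7) p by (rule vec_eqI, simp add: coord_simps algebra_simps power2_eq_square)
  ultimately show ?thesis using D unfolding attained_def by blast
qed

text \<open>
  A change of generators can be undone, so that it affects neither of the two spans.
\<close>

lemma attained_span:
  assumes "attained p11 p12 p22 m1 m2"
  shows attained_span_linear: "span {m1, m2} = span {l1, l2}"
    and attained_span_all: "span {p11, p12, p22, m1, m2} = span {q11, q12, q22, l1, l2}"
proof -
  obtain a b c d s t where D0: "a * d - b * c \<noteq> 0" and p:
     "p11 = a\<^sup>2 *s q11 + (a * b) *s q12 + b\<^sup>2 *s q22 + (s * a) *s l1 + (s * b) *s l2"
     "p12 = (2 * a * c) *s q11 + (a * d + b * c) *s q12 + (2 * b * d) *s q22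
           + (t * a + s * c) *s l1 + (t * b + s * d) *s l2"
     "p22 = c\<^sup>2 *s q11 + (c * d) *s q12 + d\<^sup>2 *s q22 + (t * c) *s l1 + (t * d) *s l2"
     "m1 = ((a * d - b * c) * a) *s l1 + ((a * d - b * c) * b) *s l2"
     "m2 = ((a * d - b * c) * c) *s l1 + ((a * d - b * c) * d) *s l2"
    using assms(1) unfolding attained_def by blast
  define D where "D = a * d - b * c"
  have D: "D \<noteq> 0" using D0 by (simp add: D_def)
  have descale: "x \<in> span S" if "k *s x = y" "k \<noteq> 0" "y \<in> span S" for x y k S
    using that span_scale[of y S "1/k"] by auto
  note sp = span_add span_diff span_scale span_base
  \<comment> \<open>Cramer's rule recovers the old quintuple from the new one.\<close>
  have cramer_l: "D\<^sup>2 *s l1 = d *s m1 - b *s m2" "D\<^sup>2 *s l2 = a *s m2 - c *s m1"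
    unfolding p D_def by (rule vec_eqI, simp add: coord_simps algebra_simps power2_eq_square)+
  have cramer_q:
    "D\<^sup>2 *s q11 = d\<^sup>2 *s p11 - (b * d) *s p12 + b\<^sup>2 *s p22 - ((d * s - b * t) * D) *s l1"
    "D\<^sup>2 *s q22 = c\<^sup>2 *s p11 - (a * c) *s p12 + a\<^sup>2 *s p22 - ((a * t - c * s) * D) *s l2"
    "D\<^sup>2 *s q12 = (- (2 * c * d)) *s p11 + (a * d + b * c) *s p12 - (2 * a * b) *s p22
       - ((a * t - c * s) * D) *s l1 - ((d * s - b * t) * D) *s l2"
    unfolding p D_def by (rule vec_eqI, simp add: coord_simps algebra_simps power2_eq_square)+
  have D2: "D\<^sup>2 \<noteq> 0" using D by simp
  have L: "l1 \<in> span S \<and> l2 \<in> span S" if m: "m1 \<in> span S" "m2 \<in> span S" for S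
    by (intro conjI descale[OF cramer_l(1) D2] descale[OF cramer_l(2) D2] sp m)
  have "m1 \<in> span {l1, l2}" "m2 \<in> span {l1, l2}"
    unfolding p by (intro sp; simp)+
  then show "span {m1, m2} = span {l1, l2}"
    using L[of "{m1,m2}"] by (simp add: span_eq sp)
  let ?S = "{p11, p12, p22, m1, m2}"
  have l: "l1 \<in> span ?S" "l2 \<in> span ?S" using L[of ?S] by (auto simp: sp)
  have "q11 \<in> span ?S"
    by (intro descale[OF cramer_q(1) D2] span_add span_diff span_scale l; rule span_base; simp)
  moreover have "q22 \<in> span ?S"
    by (intro descale[OF cramer_q(2) D2] span_add span_diff span_scale l; rule span_base; simp)
  moreover have "q12 \<in> span ?S"
    by (intro descale[OF cramer_q(3) D2] span_add span_diff span_scale l; rule span_base; simp)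
  moreover have "p11 \<in> span {q11, q12, q22, l1, l2}" "p12 \<in> span {q11, q12, q22, l1, l2}"
    "p22 \<in> span {q11, q12, q22, l1, l2}" "m1 \<in> span {q11, q12, q22, l1, l2}"
    "m2 \<in> span {q11, q12, q22, l1, l2}"
    unfolding p by (intro span_add span_scale; rule span_base; simp)+
  ultimately show "span ?S = span {q11, q12, q22, l1, l2}"
    using l by (simp add: span_eq)
qed

end

context complex_space
begin

fun indep_list :: "'v list \<Rightarrow> bool" where
  "indep_list [] \<longleftrightarrow> True"
| "indep_list (x # xs) \<longleftrightarrow> x \<notin> span (set xs) \<and> indep_list xs"

lemma indep_list: "indep_list xs \<Longrightarrow> independent (set xs) \<and> card (set xs) = length xs"
proof (induction xs)
  case (Cons x xs)
  then have "x \<notin> set xs" by (auto dest: span_base)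
  with Cons show ?case by (simp add: independent_insertI)
qed (simp add: independent_empty)

lemma in_span_coefficients:
  shows in_span1: "x \<in> span {a} \<Longrightarrow> \<exists>k. x = k *s a"
    and in_span2: "x \<in> span {a, b} \<Longrightarrow> \<exists>k l. x = k *s a + l *s b"
    and in_span3: "x \<in> span {a, b, c} \<Longrightarrow> \<exists>k l m. x = k *s a + l *s b + m *s c"
    and in_span4: "x \<in> span {a, b, c, d} \<Longrightarrow> \<exists>k l m n. x = k *s a + l *s b + m *s c + n *s d"
  by (fastforce simp: span_breakdown_eq algebra_simps)+

end

context quadratic_data
begin

abbreviation value_space :: "'v set" where "value_space \<equiv> span {q11, q12, q22, l1, l2}"

lemma attained_span_basis:
  assumes "attained p11 p12 p22 m1 m2" and "B \<subseteq> {p11, p12, p22, m1, m2}"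
    and "{p11, p12, p22, m1, m2} \<subseteq> span B"
  shows "span B = value_space"
  using attained_span_all[OF assms(1)] assms(2,3) by (metis span_mono span_span subset_antisym)

lemma attained_dim:
  assumes "attained p11 p12 p22 m1 m2" and "indep_list xs" and "set xs \<subseteq> {p11, p12, p22, m1, m2}"
    and "{p11, p12, p22, m1, m2} \<subseteq> span (set xs)"
  shows "dim value_space = length xs"
  using attained_span_basis[OF assms(1,3,4)] indep_list[OF assms(2)] dim_span_eq_card_independent
  by metis

lemma attained_shift:
  assumes "attained p11 p12 p22 m1 m2" and "r11 = p11 + s *s m1"
    and "r12 = p12 + t *s m1 + s *s m2" and "r22 = p22 + t *s m2"
  shows "attained r11 r12 r22 m1 m2"
  by (rule attained_move[OF assms(1), of 1 1 0 0 _ s _ t])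
    (use assms(2-) in \<open>simp_all add: algebra_simps\<close>)

lemma attained_shear:
  assumes "attained p11 p12 p22 m1 m2" and "r11 = p11 + b *s p12 + b\<^sup>2 *s p22"
    and "r12 = p12 + (2 * b) *s p22" and "n1 = m1 + b *s m2"
  shows "attained r11 r12 p22 n1 m2"
  by (rule attained_move[OF assms(1), of 1 1 b 0 _ 0 _ 0])
    (use assms(2-) in \<open>simp_all add: algebra_simps\<close>)

lemma attained_scale:
  assumes "attained p11 p12 p22 m1 m2" and "a \<noteq> 0" and "d \<noteq> 0"
    and "r11 = a\<^sup>2 *s p11" and "r12 = (a * d) *s p12" and "r22 = d\<^sup>2 *s p22"
    and "n1 = (a\<^sup>2 * d) *s m1" and "n2 = (a * d\<^sup>2) *s m2"
  shows "attained r11 r12 r22 n1 n2"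
  by (rule attained_move[OF assms(1), of a d 0 0 _ 0 _ 0])
    (use assms(2-) in \<open>simp_all add: algebra_simps power2_eq_square\<close>)

lemma attained_swap:
  assumes "attained p11 p12 p22 m1 m2"
  shows "attained p22 p12 p11 m2 m1"
  by (rule attained_move[OF assms(1), of 0 0 "-1" "-1" _ 0 _ 0]) (simp_all add: algebra_simps)

text \<open>
  The normal forms are listed in the order of the tables they lead to, with \<open>x, y, u, z\<close> (as far as
  they occur, in this order) standing for \<open>e\<^sub>4, e\<^sub>5, \<dots>\<close>. The value \<open>l\<^sub>1\<close> is always \<open>z\<close>, the last basis
  vector, and \<open>l\<^sub>2\<close> is \<open>0\<close> or \<open>x\<close>.
\<close>

definition normal1 where
  "normal1 z \<longleftrightarrow> attained 0 0 z z 0 \<or> attained 0 0 0 z 0"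

definition normal2 where
  "normal2 x z \<longleftrightarrow> attained x 0 0 z 0 \<or> attained 0 x 0 z 0 \<or> attained 0 0 x z 0
     \<or> attained x 0 x z 0 \<or> attained 0 0 0 z x \<or> attained x 0 0 z x \<or> attained 0 x 0 z x
     \<or> attained x 0 x z x \<or> attained x 0 z z 0 \<or> attained 0 x z z 0"

definition normal3 where
  "normal3 x y z \<longleftrightarrow> attained y x 0 z 0 \<or> attained y 0 x z 0 \<or> attained y 0 0 z x
     \<or> attained y 0 x z x \<or> attained 0 y x z 0 \<or> attained x y x z 0 \<or> attained 0 y 0 z x
     \<or> attained x y 0 z x \<or> attained x 0 y z x \<or> attained (x + y) 0 y z x
     \<or> attained y x z z 0"

definition normal4 where
  "normal4 x y u z \<longleftrightarrow> attained u y x z 0 \<or> attained u y 0 z x \<or> attained u 0 y z x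
     \<or> attained x u y z x"

definition classified where
  "classified \<longleftrightarrow> dim value_space = 1 \<and> (\<exists>z. normal1 z) \<or> dim value_space = 2 \<and> (\<exists>x z. normal2 x z)
     \<or> dim value_space = 3 \<and> (\<exists>x y z. normal3 x y z) \<or> dim value_space = 4 \<and> (\<exists>x y u z. normal4 x y u z)
     \<or> dim value_space = 5 \<and> (\<exists>x y u z w. attained x y u z w)"

section \<open>Normal forms for a linear part of rank one\<close>

lemma normalise_p22:
  assumes "attained p11 p12 (k *s m) m 0" and "k \<noteq> 0"
  shows "attained p11 ((1 / k) *s p12) ((1 / k) *s m) ((1 / k) *s m) 0"
  by (rule attained_scale[OF assms(1), of 1 "1 / k"])
    (use assms(2) in \<open>simp_all add: power2_eq_square\<close>)

text \<open>
  The dimension of \<open>V\<close> is one more than the rank of the quadratic part modulo \<open>m\<close>. As the second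
  entry of the linear part vanishes, a shear changes neither \<open>m\<close> nor \<open>p22\<close>; it serves to complete
  the square, and a shift removes multiples of \<open>m\<close> from \<open>p11\<close> and \<open>p12\<close>. The case distinctions
  follow the order \<open>p22\<close>, \<open>p12\<close>, \<open>p11\<close>, since shears add later entries of this list to earlier ones.
\<close>

lemma classified_rank_one:
  assumes h: "attained p11 p12 p22 m 0" and m: "m \<noteq> 0"
  shows classified
proof (cases "p22 \<in> span {m}")
  case True
  then obtain k where k: "p22 = k *s m" using in_span1 by blast
  show ?thesis
  proof (cases "p12 \<in> span {m}")
    case True
    then obtain y where y: "p12 = y *s m" using in_span1 by blast
    show ?thesis
    proof (cases "p11 \<in> span {m}")
      case True
      then obtain x where x: "p11 = x *s m" using in_span1 by blast
      have "dim value_space = length [m]"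
        by (rule attained_dim[OF h]) (use m in \<open>simp_all add: k x y span_base span_scale span_zero\<close>)
      moreover have h': "attained 0 0 (k *s m) m 0"
        by (rule attained_shift[OF h, of _ "-x" _ "-y"]) (simp_all add: x y k)
      have "\<exists>z. normal1 z"
        using h' normalise_p22[OF h'] by (cases "k = 0") (auto simp: normal1_def)
      ultimately show ?thesis unfolding classified_def by simp
    next
      case False
      have "dim value_space = length [p11, m]"
        by (rule attained_dim[OF h]) (use m False in \<open>simp_all add: k y span_base span_scale span_zero\<close>)
      moreover have h': "attained p11 0 (k *s m) m 0"
        by (rule attained_shift[OF h, of _ 0 _ "-y"]) (simp_all add: y k)
      have "\<exists>x z. normal2 x z"
        using h' normalise_p22[OF h'] by (cases "k = 0") (auto simp: normal2_def)
      ultimately show ?thesis unfolding classified_def by simp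
    qed
  next
    case False
    show ?thesis
    proof (cases "p11 \<in> span {p12, m}")
      case True
      then obtain x w where x: "p11 = x *s p12 + w *s m" using in_span2 by blast
      have "dim value_space = length [p12, m]"
        by (rule attained_dim[OF h])
          (use m False in \<open>simp_all add: k x span_base span_scale span_zero span_add\<close>)
      moreover have h1: "attained (w *s m + (x\<^sup>2 * k) *s m) (p12 - (2 * x * k) *s m) (k *s m) m 0"
        by (rule attained_shear[OF h[unfolded k], of _ "-x"])
          (rule vec_eqI, simp add: x coord_simps algebra_simps power2_eq_square)+
      have h': "attained 0 (p12 - (2 * x * k) *s m) (k *s m) m 0"
        by (rule attained_shift[OF h1, of _ "- (w + x\<^sup>2 * k)" _ 0])
          (simp_all add: algebra_simps)
      have "\<exists>x z. normal2 x z"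
        using h' normalise_p22[OF h'] by (cases "k = 0") (auto simp: normal2_def)
      ultimately show ?thesis unfolding classified_def by simp
    next
      case F2: False
      have "dim value_space = length [p11, p12, m]"
        by (rule attained_dim[OF h])
          (use m False F2 in \<open>simp_all add: k span_base span_scale span_zero span_add\<close>)
      moreover have "\<exists>x y z. normal3 x y z"
        using h[unfolded k] normalise_p22[OF h[unfolded k]] by (cases "k = 0") (auto simp: normal3_def)
      ultimately show ?thesis unfolding classified_def by simp
    qed
  qed
next
  case p22: False
  show ?thesis
  proof (cases "p12 \<in> span {p22, m}")
    case p12: True
    then obtain y w where y: "p12 = y *s p22 + w *s m" using in_span2 by blast
    define r where "r = p11 - (y / 2) *s p12 + (y\<^sup>2 / 4) *s p22"
    have h1: "attained r (w *s m) p22 (m + (-y/2) *s 0) 0"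
      by (rule attained_shear[OF h, of _ "- y/2"])
        (simp_all add: y r_def power_divide)
    then have h1: "attained r (w *s m) p22 m 0" by simp
    have h2: "attained (r + s *s m) 0 p22 m 0" for s
      by (rule attained_shift[OF h1, of _ s _ "-w"]) simp_all
    show ?thesis
    proof (cases "p11 \<in> span {p22, m}")
      case True
      then have "r \<in> span {p22, m}"
        unfolding r_def using p12 by (simp add: span_add span_diff span_scale span_base)
      then obtain x v where x: "r = x *s p22 + v *s m" using in_span2 by blast
      have "dim value_space = length [p22, m]"
        by (rule attained_dim[OF h])
          (use m True p12 p22 in \<open>simp_all add: span_base span_zero\<close>)
      moreover have h3: "attained (x *s p22) 0 p22 m 0"
        using h2[of "-v"] by (simp add: x)
      have "\<exists>x z. normal2 x z"
      proof (cases "x = 0")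
        case True then show ?thesis using h3 by (auto simp: normal2_def)
      next
        case False
        then have "attained p22 0 p22 ((1 / csqrt x)\<^sup>2 *s m) 0"
          by (intro attained_scale[OF h3, of "1 / csqrt x" 1]) (simp_all add: power_divide)
        then show ?thesis by (auto simp: normal2_def)
      qed
      ultimately show ?thesis unfolding classified_def by simp
    next
      case False
      have "dim value_space = length [p11, p22, m]"
        by (rule attained_dim[OF h])
          (use m False p12 p22 in \<open>simp_all add: y span_base span_zero span_add span_scale\<close>)
      moreover have "\<exists>x y z. normal3 x y z"
        using h2[of 0] by (auto simp: normal3_def)
      ultimately show ?thesis unfolding classified_def by simp
    qed
  next
    case p12: False
    show ?thesis
    proof (cases "p11 \<in> span {p12, p22, m}")
      case True
      then obtain x y w where x: "p11 = x *s p12 + y *s p22 + w *s m" using in_span3 by blast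
      have "dim value_space = length [p12, p22, m]"
        by (rule attained_dim[OF h])
          (use m True p12 p22 in \<open>simp_all add: span_base span_zero\<close>)
      define r where "r = p12 - (2 * x) *s p22"
      have h1: "attained ((y + x\<^sup>2) *s p22 + w *s m) r p22 (m + (-x) *s 0) 0"
        by (rule attained_shear[OF h, of _ "-x"])
          (simp_all add: x r_def algebra_simps)
      have h2: "attained ((y + x\<^sup>2) *s p22) r p22 m 0"
        by (rule attained_shift[OF h1[simplified], of _ "-w" _ 0]) simp_all
      have "\<exists>x y z. normal3 x y z"
      proof (cases "y + x\<^sup>2 = 0")
        case True then show ?thesis using h2 by (auto simp: normal3_def)
      next
        case False
        let ?a = "1 / csqrt (y + x\<^sup>2)"
        have "attained p22 (?a *s r) p22 (?a\<^sup>2 *s m) 0"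
          by (rule attained_scale[OF h2, of ?a 1]) (use False in \<open>simp_all add: power_divide\<close>)
        then show ?thesis by (auto simp: normal3_def)
      qed
      with \<open>dim value_space = _\<close> show ?thesis unfolding classified_def by simp
    next
      case False
      have "dim value_space = length [p11, p12, p22, m]"
        by (rule attained_dim[OF h])
          (use m False p12 p22 in \<open>simp_all add: span_base span_zero\<close>)
      moreover have "\<exists>x y u z. normal4 x y u z"
        using h by (auto simp: normal4_def)
      ultimately show ?thesis unfolding classified_def by simp
    qed
  qed
qed

section \<open>Normal forms for a linear part of rank two\<close>

lemma attained_same_linear_span:
  assumes "attained p11 p12 p22 m1 m2" and "attained r11 r12 r22 n1 n2"
  shows "span {n2, n1} = span {m2, m1}"
  using assms[THEN attained_span_linear] by (simp add: insert_commute)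

text \<open>
  Here \<open>q \<and> l\<close> is a multiple of \<open>x (\<alpha> x\<^sup>2 + \<beta> x y + \<gamma> y\<^sup>2)\<close>, and the normal forms correspond to the
  cubics that are zero, a cube, divisible by the square of a linear form but not a cube,
  or square-free.
\<close>

lemma normal2_reduced_cubic:
  assumes h: "attained (\<alpha> *s m2) (\<beta> *s m2) (\<gamma> *s m2) m1 m2"
  shows "\<exists>x z. normal2 x z"
proof -
  have mixed: "\<exists>x z. normal2 x z" if h: "attained 0 (k *s n2) 0 n1 n2" and "k \<noteq> 0" for k n1 n2
  proof -
    have "attained 0 (k\<^sup>2 *s n2) 0 (k *s n1) (k\<^sup>2 *s n2)"
      by (rule attained_scale[OF h, of 1 k]) (use \<open>k \<noteq> 0\<close> in \<open>simp_all add: power2_eq_square\<close>)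
    then show ?thesis by (auto simp: normal2_def)
  qed
  show ?thesis
  proof (cases "\<gamma> = 0")
    case g: True
    show ?thesis
    proof (cases "\<beta> = 0")
      case b: True
      show ?thesis
      proof (cases "\<alpha> = 0")
        case True
        then show ?thesis using h g b by (auto simp: normal2_def)
      next
        case False
        have "attained ((1 / \<alpha>) *s m2) 0 0 ((1 / \<alpha>)\<^sup>2 *s m1) ((1 / \<alpha>) *s m2)"
          by (rule attained_scale[OF h, of "1 / \<alpha>" 1])
            (use False g b in \<open>simp_all add: power2_eq_square\<close>)
        then show ?thesis by (auto simp: normal2_def)
      qed
    next
      case False
      have "attained 0 (\<beta> *s m2) 0 (m1 + (- \<alpha> / \<beta>) *s m2) m2"
        using attained_shear[OF h, of 0 "- \<alpha> / \<beta>" "\<beta> *s m2"] g False by simp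
      from mixed[OF this False] show ?thesis .
    qed
  next
    case g: False
    define b where "b = - \<beta> / (2 * \<gamma>)"
    have b: "\<beta> = - (2 * \<gamma> * b)" using g by (simp add: b_def)
    define a where "a = \<alpha> + b * \<beta> + b\<^sup>2 * \<gamma>"
    define n where "n = m1 + b *s m2"
    have h1: "attained (a *s m2) 0 (\<gamma> *s m2) n m2"
      by (rule attained_shear[OF h, of _ b])
        (simp_all add: n_def a_def b algebra_simps)
    show ?thesis
    proof (cases "a = 0")
      case True
      \<comment> \<open>The cubic is \<open>x y\<^sup>2\<close>; swapping the generators puts the double line first.\<close>
      have "attained (\<gamma> *s m2) 0 0 m2 n"
        using attained_swap[OF h1] True by simp
      then have "attained 0 ((- \<gamma>) *s n) 0 m2 n"
        by (rule attained_shift[of _ _ _ _ _ _ "- \<gamma>" _ 0]) simp_all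
      from mixed[OF this] show ?thesis using g by simp
    next
      case False
      define r where "r = csqrt (a * \<gamma>)"
      have r: "r\<^sup>2 = a * \<gamma>" by (simp add: r_def)
      have r0: "r \<noteq> 0" using False g by (simp add: r_def)
      have "attained ((a * \<gamma>\<^sup>2) *s m2) 0 ((a * \<gamma>\<^sup>2) *s m2) ((\<gamma>\<^sup>2 * r) *s n) ((a * \<gamma>\<^sup>2) *s m2)"
        by (rule attained_scale[OF h1 g r0]) (simp_all add: r power2_eq_square[of \<gamma>] mult.commute)
      then show ?thesis by (auto simp: normal2_def)
    qed
  qed
qed

text \<open>
  Over the complex numbers the cubic \<open>q \<and> l\<close> has a root. With a root as second generator, \<open>q\<close> and
  \<open>l\<close> become proportional there, and a shift then moves all of \<open>q\<close> into the line of \<open>m2\<close>.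
\<close>

lemma normal2_cubic:
  assumes h: "attained p11 p12 p22 m1 m2"
    and "p11 \<in> span {m2, m1}" "p12 \<in> span {m2, m1}" "p22 \<in> span {m2, m1}"
  shows "\<exists>x z. normal2 x z"
proof -
  obtain b1 a1 where p11: "p11 = b1 *s m2 + a1 *s m1" using in_span2 assms(2) by blast
  obtain b2 a2 where p12: "p12 = b2 *s m2 + a2 *s m1" using in_span2 assms(3) by blast
  obtain b3 a3 where p22: "p22 = b3 *s m2 + a3 *s m1" using in_span2 assms(4) by blast
  have "\<exists>r11 r12 k n1 n2. attained r11 r12 (k *s n2) n1 n2 \<and> r11 \<in> span {n2, n1} \<and> r12 \<in> span {n2, n1}"
  proof (cases "a3 = 0")
    case True
    then show ?thesis using h assms(2,3) p22 by force
  next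
    case False
    then obtain y where "poly [: - b1, a1 - b2, a2 - b3, a3 :] y = 0"
      using alg_closed_imp_poly_has_root[of "[: - b1, a1 - b2, a2 - b3, a3 :]"] by auto
    moreover have "poly [: - b1, a1 - b2, a2 - b3, a3 :] y
        = (a1 + a2 * y + a3 * y\<^sup>2) * y - (b1 + b2 * y + b3 * y\<^sup>2)"
      by (simp add: algebra_simps power2_eq_square)
    ultimately have y: "(a1 + a2 * y + a3 * y\<^sup>2) * y = b1 + b2 * y + b3 * y\<^sup>2"
      by simp
    \<comment> \<open>Since \<open>a3 \<noteq> 0\<close>, the root is not \<open>(0, 1)\<close> and has the form \<open>(1, y)\<close>; it becomes the second generator,
      and \<open>e\<^sub>2\<close> the first.\<close>
    define n where "n = - m1 - y *s m2"
    define k where "k = - (a1 + a2 * y + a3 * y\<^sup>2)"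
    have "coord b (k *s n) = coord b (p11 + y *s p12 + y\<^sup>2 *s p22)" for b
    proof -
      have "coord b (k *s n)
          = (a1 + a2 * y + a3 * y\<^sup>2) * coord b m1 + ((a1 + a2 * y + a3 * y\<^sup>2) * y) * coord b m2"
        by (simp add: n_def k_def coord_simps algebra_simps)
      then show ?thesis
        unfolding y by (simp add: p11 p12 p22 coord_simps algebra_simps)
    qed
    then have k: "k *s n = p11 + y *s p12 + y\<^sup>2 *s p22" by (rule vec_eqI)
    have h1: "attained p22 (p12 + (2 * y) *s p22) (k *s n) (- m2) n"
      by (rule attained_move[OF h, of 0 y 1 1 _ 0 _ 0]) (simp_all add: k, simp_all add: n_def)
    moreover have "span {n, - m2} = span {m2, m1}"
      by (rule attained_same_linear_span[OF h h1])
    ultimately show ?thesis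
      using assms(3,4) by (metis span_add span_scale)
  qed
  then obtain r11 r12 k n1 n2 where h1: "attained r11 r12 (k *s n2) n1 n2"
    and r: "r11 \<in> span {n2, n1}" "r12 \<in> span {n2, n1}"
    by blast
  obtain d1 c1 where r11: "r11 = d1 *s n2 + c1 *s n1" using in_span2 r(1) by blast
  obtain d2 c2 where r12: "r12 = d2 *s n2 + c2 *s n1" using in_span2 r(2) by blast
  have "attained (d1 *s n2) ((d2 - c1) *s n2) ((k - c2) *s n2) n1 n2"
    by (rule attained_shift[OF h1, of _ "- c1" _ "- c2"]) (simp_all add: r11 r12 algebra_simps)
  then show ?thesis by (rule normal2_reduced_cubic)
qed

text \<open>
  Modulo \<open>L\<close> the quadratic part is a multiple of \<open>x y\<close>, and every cubic is \<open>\<beta> x\<^sup>3 + \<gamma> y\<^sup>3\<close> modulo the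
  multiples of \<open>x y\<close>. It only matters how many of the two coefficients vanish.
\<close>

lemma normal3_hyperbolic:
  assumes h: "attained p11 p12 p22 m1 m2"
    and "p11 \<in> span {m2, m1}" "p22 \<in> span {m2, m1}"
  shows "\<exists>x y z. normal3 x y z"
proof -
  obtain b1 a1 where p11: "p11 = b1 *s m2 + a1 *s m1" using in_span2 assms(2) by blast
  obtain b3 a3 where p22: "p22 = b3 *s m2 + a3 *s m1" using in_span2 assms(3) by blast
  define v where "v = p12 - b3 *s m1 - a1 *s m2"
  have h1: "attained (b1 *s m2) v (a3 *s m1) m1 m2"
    by (rule attained_shift[OF h, of _ "- a1" _ "- b3"])
      (simp_all add: p11 p22 v_def algebra_simps)
  have one: "\<exists>x y z. normal3 x y z" if h: "attained (k *s n2) w 0 n1 n2" and "k \<noteq> 0" for k w n1 n2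
  proof -
    have "attained ((1 / k) *s n2) ((1 / k) *s w) 0 ((1 / k)\<^sup>2 *s n1) ((1 / k) *s n2)"
      by (rule attained_scale[OF h, of "1 / k" 1]) (use \<open>k \<noteq> 0\<close> in \<open>simp_all add: power2_eq_square\<close>)
    then show ?thesis by (auto simp: normal3_def)
  qed
  consider "b1 = 0" "a3 = 0" | "b1 \<noteq> 0" "a3 = 0" | "b1 = 0" "a3 \<noteq> 0" | "b1 \<noteq> 0" "a3 \<noteq> 0"
    by blast
  then show ?thesis
  proof cases
    case 1
    then show ?thesis using h1 by (auto simp: normal3_def)
  next
    case 2
    then show ?thesis using h1 one by simp
  next
    case 3
    then show ?thesis using attained_swap[OF h1] one by simp
  next
    case 4
    \<comment> \<open>After scaling both coefficients to \<open>c\<close>, the generators \<open>\<i> (e\<^sub>1 - e\<^sub>2)\<close> and \<open>e\<^sub>1 + e\<^sub>2\<close> turn \<open>x y\<close> into a sum of two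
      squares, and \<open>p11\<close> and \<open>p22\<close> then differ by \<open>2 \<i> c\<close> times the second linear value.\<close>
    define c where "c = - \<i> / 2"
    have c: "c \<noteq> 0" by (simp add: c_def)
    obtain d where d: "d ^ 3 = a3 * b1\<^sup>2 / c ^ 3" using nth_root_exists[of 3] by auto
    then have d0: "d \<noteq> 0" using 4 c by auto
    define a where "a = c * d\<^sup>2 / b1"
    have a0: "a \<noteq> 0" using 4 c d0 by (simp add: a_def)
    have e1: "a * b1 = c * d\<^sup>2" using 4 by (simp add: a_def)
    have "c * a\<^sup>2 * b1\<^sup>2 = c ^ 3 * d ^ 3 * d"
      by (simp add: a_def power_divide 4 power_mult_distrib power2_eq_square power3_eq_cube)
    also have "\<dots> = a3 * d * b1\<^sup>2" using c by (simp add: d)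
    finally have e2: "c * a\<^sup>2 = a3 * d" using 4 by simp
    define n1 where "n1 = (a\<^sup>2 * d) *s m1"
    define n2 where "n2 = (a * d\<^sup>2) *s m2"
    define w where "w = (a * d) *s v"
    have "a\<^sup>2 * b1 = c * (a * d\<^sup>2)" using e1 by (simp add: power2_eq_square)
    moreover have "d\<^sup>2 * a3 = c * (a\<^sup>2 * d)" using e2 by (simp add: power2_eq_square)
    ultimately have h2: "attained (c *s n2) w (c *s n1) n1 n2"
      by (intro attained_scale[OF h1 a0 d0]) (simp_all add: n1_def n2_def w_def)
    define x where "x = (2 * \<i>) *s n1 + (2 * \<i>) *s n2"
    define r where "r = w - (3 * \<i> / 2) *s (n1 + n2)"
    have "attained (x + r) 0 r ((- 2) *s n1 + 2 *s n2) x"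
      by (rule attained_move[OF h2, of \<i> 1 "- \<i>" 1 _ 0 _ "- \<i>"])
        (auto intro!: vec_eqI simp: x_def r_def c_def coord_simps algebra_simps)
    then show ?thesis by (auto simp: normal3_def)
  qed
qed

text \<open>
  Modulo \<open>L\<close> the quadratic part is a multiple of \<open>x\<^sup>2\<close>, so that only the terms \<open>x y\<^sup>2\<close> and \<open>y\<^sup>3\<close> of the
  cubic survive. If \<open>y\<^sup>3\<close> occurs, a shear removes \<open>x y\<^sup>2\<close>.
\<close>

lemma normal3_square:
  assumes h: "attained p11 p12 p22 m1 m2"
    and "p12 \<in> span {m2, m1}" "p22 \<in> span {m2, m1}"
  shows "\<exists>x y z. normal3 x y z"
proof -
  obtain b2 a2 where p12: "p12 = b2 *s m2 + a2 *s m1" using in_span2 assms(2) by blast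
  obtain b3 a3 where p22: "p22 = b3 *s m2 + a3 *s m1" using in_span2 assms(3) by blast
  define v where "v = p11 - b2 *s m1"
  define \<beta> where "\<beta> = b3 - a2"
  have h1: "attained v 0 (a3 *s m1 + \<beta> *s m2) m1 m2"
    by (rule attained_shift[OF h, of _ "- b2" _ "- a2"])
      (simp_all add: p12 p22 v_def \<beta>_def algebra_simps)
  show ?thesis
  proof (cases "a3 = 0")
    case a3: True
    show ?thesis
    proof (cases "\<beta> = 0")
      case True
      then show ?thesis using h1 a3 by (auto simp: normal3_def)
    next
      case False
      have "attained (\<beta>\<^sup>2 *s v) 0 (\<beta> *s m2) (\<beta>\<^sup>2 *s m1) (\<beta> *s m2)"
        by (rule attained_scale[OF h1, of \<beta> 1]) (use False a3 in simp_all)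
      then show ?thesis by (auto simp: normal3_def)
    qed
  next
    case a3: False
    \<comment> \<open>The shear changes the coefficient \<open>\<beta>\<close> into \<open>\<beta> - 3 a3 b\<close>: once from \<open>m1\<close> itself, twice from the shift
      that clears the mixed term.\<close>
    define b where "b = \<beta> / (3 * a3)"
    have b: "\<beta> = 3 * a3 * b" using a3 by (simp add: b_def)
    define s where "s = 2 * b\<^sup>2 * a3 - 2 * b * \<beta>"
    define n where "n = m1 + b *s m2"
    define r where "r = v + b\<^sup>2 *s (a3 *s m1 + \<beta> *s m2) + s *s m1 + (s * b) *s m2"
    have "attained r 0 (a3 *s n) n m2"
      by (rule attained_move[OF h1, of 1 1 b 0 _ s _ "- (2 * b * a3)"])
        (auto intro!: vec_eqI simp: b n_def r_def s_def coord_simps algebra_simps power2_eq_square)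
    then have h2: "attained (a3 *s n) 0 r m2 n" by (rule attained_swap)
    have "attained ((1 / a3) *s n) 0 r ((1 / a3)\<^sup>2 *s m2) ((1 / a3) *s n)"
      by (rule attained_scale[OF h2, of "1 / a3" 1]) (use a3 in \<open>simp_all add: power2_eq_square\<close>)
    then show ?thesis by (auto simp: normal3_def)
  qed
qed

text \<open>
  The scalar quadratic forms arising modulo \<open>L\<close> all lie in the span of \<open>x\<^sup>2\<close> and \<open>x y\<close>, whose
  multiples miss only the cubic \<open>y\<^sup>3\<close>; its coefficient is zero or can be scaled to one.
\<close>

lemma normal4_tangent:
  assumes h: "attained p11 p12 p22 m1 m2" and "p22 \<in> span {m2, m1}"
  shows "\<exists>x y u z. normal4 x y u z"
proof -
  obtain b3 a3 where p22: "p22 = b3 *s m2 + a3 *s m1" using in_span2 assms(2) by blast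
  define v where "v = p12 - b3 *s m1"
  have h1: "attained p11 v (a3 *s m1) m1 m2"
    by (rule attained_shift[OF h, of _ 0 _ "- b3"]) (simp_all add: p22 v_def algebra_simps)
  show ?thesis
  proof (cases "a3 = 0")
    case True
    then show ?thesis using h1 by (auto simp: normal4_def)
  next
    case False
    let ?k = "1 / a3"
    have "attained (?k *s m1) (?k *s v) p11 (?k\<^sup>2 *s m2) (?k *s m1)"
      by (rule attained_scale[OF attained_swap[OF h1], of ?k 1])
        (use False in \<open>simp_all add: power2_eq_square\<close>)
    then show ?thesis by (auto simp: normal4_def)
  qed
qed

text \<open>
  The multiples of \<open>x\<^sup>2\<close> and \<open>y\<^sup>2\<close> together span all binary cubics, so no invariant is left.
\<close>

lemma normal4_secant:
  assumes h: "attained p11 p12 p22 m1 m2" and "p12 \<in> span {m2, m1}"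
  shows "\<exists>x y u z. normal4 x y u z"
proof -
  obtain b a where p12: "p12 = b *s m2 + a *s m1" using in_span2 assms(2) by blast
  have "attained (p11 - b *s m1) 0 (p22 - a *s m2) m1 m2"
    by (rule attained_shift[OF h, of _ "- b" _ "- a"]) (simp_all add: p12)
  then show ?thesis by (auto simp: normal4_def)
qed

text \<open>
  It remains to bring the quadratic part modulo the span of \<open>m1, m2\<close> into the shape of one of
  the preceding lemmas. Completing the square and swapping the generators handles the degenerate
  positions. When \<open>p11\<close> is a non-zero multiple of \<open>p22\<close> modulo that span, the generators
  \<open>e\<^sub>1 + \<rho> e\<^sub>2\<close> and \<open>e\<^sub>1 - \<rho> e\<^sub>2\<close>, for a suitable square root \<open>\<rho>\<close>, remove the two squares if the mixed
  term vanishes modulo that span, and the mixed term otherwise.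
\<close>

lemma classified_rank_two:
  assumes h: "attained p11 p12 p22 m1 m2" and m1: "m1 \<noteq> 0" and m2: "m2 \<notin> span {m1}"
  shows classified
proof -
  let ?S = "span {m2, m1}"
  note mem = span_base span_zero span_add span_diff span_scale
  have basis_l: "indep_list [m2, m1]" using m1 m2 by simp
  have same: "span {n2, n1} = ?S" if "attained r11 r12 r22 n1 n2" for r11 r12 r22 n1 n2
    by (rule attained_same_linear_span[OF h that])
  have dim: "dim value_space = length (xs @ [m2, m1])"
    if "set xs \<subseteq> {p11, p12, p22}" "indep_list (xs @ [m2, m1])"
      and "p11 \<in> span (set (xs @ [m2, m1]))" "p12 \<in> span (set (xs @ [m2, m1]))"
        "p22 \<in> span (set (xs @ [m2, m1]))" for xs
    by (rule attained_dim[OF h that(2)]) (use that in \<open>auto intro: span_base\<close>)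
  have wider: "x \<in> span T" if "x \<in> ?S" "{m2, m1} \<subseteq> T" for x T
    using that span_mono by blast
  show ?thesis
  proof (cases "p22 \<in> ?S")
    case p22: True
    show ?thesis
    proof (cases "p12 \<in> ?S")
      case p12: True
      show ?thesis
      proof (cases "p11 \<in> ?S")
        case True
        have "dim value_space = 2" using dim[of "[]"] basis_l True p12 p22 by simp
        moreover have "\<exists>x z. normal2 x z" by (rule normal2_cubic[OF h True p12 p22])
        ultimately show ?thesis unfolding classified_def by blast
      next
        case False
        have "dim value_space = 3" using dim[of "[p11]"] basis_l False p12 p22 by (simp add: wider mem)
        moreover have "\<exists>x y z. normal3 x y z" by (rule normal3_square[OF h p12 p22])
        ultimately show ?thesis unfolding classified_def by blast
      qed
    next
      case p12: False
      show ?thesis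
      proof (cases "p11 \<in> span {p12, m2, m1}")
        case True
        then obtain x w2 w1 where x: "p11 = x *s p12 + w2 *s m2 + w1 *s m1" using in_span3 by blast
        have dimv: "dim value_space = 3" using dim[of "[p12]"] basis_l True p12 p22 by (simp add: wider mem)
        define r where "r = w2 *s m2 + w1 *s m1 + x\<^sup>2 *s p22"
        have h1: "attained r (p12 - (2 * x) *s p22) p22 (m1 - x *s m2) m2"
          by (rule attained_shear[OF h, of _ "- x"]) (simp_all add: r_def x)
        have "r \<in> ?S" unfolding r_def using p22 by (simp add: mem)
        then have "\<exists>x y z. normal3 x y z"
          using normal3_hyperbolic[OF h1] p22 unfolding same[OF h1] by blast
        with dimv show ?thesis unfolding classified_def by blast
      next
        case False
        have "dim value_space = 4" using dim[of "[p11, p12]"] basis_l False p12 p22 by (simp add: wider mem)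
        moreover have "\<exists>x y u z. normal4 x y u z" by (rule normal4_tangent[OF h p22])
        ultimately show ?thesis unfolding classified_def by blast
      qed
    qed
  next
    case p22: False
    show ?thesis
    proof (cases "p12 \<in> span {p22, m2, m1}")
      case p12: True
      then obtain y w2 w1 where y: "p12 = y *s p22 + w2 *s m2 + w1 *s m1" using in_span3 by blast
      define r11 where "r11 = p11 - (y / 2) *s p12 + (y\<^sup>2 / 4) *s p22"
      define r12 where "r12 = w2 *s m2 + w1 *s m1"
      have r12: "r12 \<in> ?S" by (simp add: r12_def mem)
      define n where "n = m1 - (y / 2) *s m2"
      have h1: "attained r11 r12 p22 n m2"
        by (rule attained_shear[OF h, of _ "- y / 2"])
          (simp_all add: r11_def r12_def n_def y power_divide)
      show ?thesis
      proof (cases "p11 \<in> span {p22, m2, m1}")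
        case True
        have dimv: "dim value_space = 3" using dim[of "[p22]"] basis_l True p12 p22 by (simp add: wider mem)
        have "r11 \<in> span {p22, m2, m1}"
          unfolding r11_def using True p12 by (simp add: mem)
        then obtain x v2 v1 where x: "r11 = x *s p22 + v2 *s m2 + v1 *s m1" using in_span3 by blast
        have "\<exists>x y z. normal3 x y z"
        proof (cases "x = 0")
          case True
          then have "r11 \<in> ?S" by (simp add: x mem)
          note h2 = attained_swap[OF h1]
          show ?thesis
            using normal3_square[OF h2] r12 \<open>r11 \<in> ?S\<close> unfolding same[OF h2] by blast
        next
          case False
          define \<rho> where "\<rho> = csqrt (- x)"
          have \<rho>: "\<rho>\<^sup>2 = - x" "\<rho> \<noteq> 0" using False by (simp_all add: \<rho>_def)
          have x': "x = - (\<rho> * \<rho>)" using \<rho>(1) by (simp add: power2_eq_square)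
          define z where "z = v2 *s m2 + v1 *s m1"
          have z: "z \<in> ?S" by (simp add: z_def mem)
          have h2: "attained (z + \<rho> *s r12) ((- 2 * \<rho>\<^sup>2 + 2 * x) *s p22 + 2 *s z) (z - \<rho> *s r12)
              ((- 2 * \<rho>) *s (n + \<rho> *s m2)) ((- 2 * \<rho>) *s (n - \<rho> *s m2))"
            by (rule attained_move[OF h1, of 1 "- \<rho>" \<rho> 1 _ 0 _ 0])
              (use \<rho>(2) in \<open>auto intro!: vec_eqI simp: x x' z_def coord_simps algebra_simps power2_eq_square\<close>)
          show ?thesis
            using normal3_hyperbolic[OF h2] z r12 unfolding same[OF h2] by (simp add: mem)
        qed
        with dimv show ?thesis unfolding classified_def by blast
      next
        case False
        have "dim value_space = 4" using dim[of "[p11, p22]"] basis_l False p12 p22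
          by (simp add: wider mem y)
        moreover have "\<exists>x y u z. normal4 x y u z"
          using normal4_secant[OF h1] r12 unfolding same[OF h1] by blast
        ultimately show ?thesis unfolding classified_def by blast
      qed
    next
      case p12: False
      show ?thesis
      proof (cases "p11 \<in> span {p12, p22, m2, m1}")
        case True
        then obtain x y w2 w1 where x: "p11 = x *s p12 + y *s p22 + w2 *s m2 + w1 *s m1"
          using in_span4 by blast
        have dimv: "dim value_space = 4" using dim[of "[p12, p22]"] basis_l True p12 p22 by (simp add: mem)
        define z where "z = w2 *s m2 + w1 *s m1"
        have z: "z \<in> ?S" by (simp add: z_def mem)
        define \<mu> where "\<mu> = y + x\<^sup>2"
        define r12 where "r12 = p12 - (2 * x) *s p22"
        define n where "n = m1 - x *s m2"
        have h1: "attained (\<mu> *s p22 + z) r12 p22 n m2"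
          by (rule attained_shear[OF h, of _ "- x"])
            (simp_all add: x r12_def n_def \<mu>_def z_def algebra_simps)
        have "\<exists>x y u z. normal4 x y u z"
        proof (cases "\<mu> = 0")
          case True
          then have h2: "attained p22 r12 z m2 n" using attained_swap[OF h1] by simp
          show ?thesis using normal4_tangent[OF h2] z unfolding same[OF h2] by blast
        next
          case False
          define \<rho> where "\<rho> = csqrt \<mu>"
          have \<rho>: "\<rho> \<noteq> 0" using False by (simp add: \<rho>_def)
          have \<mu>: "\<mu> = \<rho> * \<rho>" by (simp add: \<rho>_def flip: power2_eq_square)
          have h2: "attained ((2 * \<mu>) *s p22 + \<rho> *s r12 + z) (2 *s z) ((2 * \<mu>) *s p22 - \<rho> *s r12 + z)
              ((- 2 * \<rho>) *s (n + \<rho> *s m2)) ((- 2 * \<rho>) *s (n - \<rho> *s m2))"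
            by (rule attained_move[OF h1, of 1 "- \<rho>" \<rho> 1 _ 0 _ 0])
              (use \<rho> in \<open>auto intro!: vec_eqI simp: \<mu> coord_simps algebra_simps power2_eq_square\<close>)
          show ?thesis
            using normal4_secant[OF h2] z unfolding same[OF h2] by (simp add: mem)
        qed
        with dimv show ?thesis unfolding classified_def by blast
      next
        case False
        have "dim value_space = 5" using dim[of "[p11, p12, p22]"] basis_l False p12 p22 by (simp add: mem)
        then show ?thesis using h unfolding classified_def by blast
      qed
    qed
  qed
qed

lemma classification:
  assumes "l1 \<noteq> 0 \<or> l2 \<noteq> 0"
  shows classified
proof -
  obtain p11 p12 p22 m1 m2 where h: "attained p11 p12 p22 m1 m2" and m1: "m1 \<noteq> 0"
    using attained_start attained_swap[OF attained_start] assms by blast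
  show ?thesis
  proof (cases "m2 \<in> span {m1}")
    case True
    then obtain k where k: "m2 = k *s m1" using in_span1 by blast
    have "attained p11 (p12 - (2 * k) *s p11) (p22 - k *s p12 + k\<^sup>2 *s p11) m1 0"
      by (rule attained_move[OF h, of 1 1 0 "- k" _ 0 _ 0]) (simp_all add: k)
    then show ?thesis using m1 by (rule classified_rank_one)
  next
    case False
    then show ?thesis by (rule classified_rank_two[OF h m1])
  qed
qed

end

section \<open>Coordinates with respect to a list\<close>

context complex_space
begin

text \<open>
  The combination of \<open>vs\<close> whose coefficients are \<open>w n, w (n + 1), \<dots>\<close>; for \<open>n = 4\<close> these are the
  coordinates of a table algebra that lie beyond those of \<open>N1\<close>.
\<close>

fun comb :: "nat \<Rightarrow> 'v list \<Rightarrow> (nat \<Rightarrow> complex) \<Rightarrow> 'v" where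
  "comb n [] w = 0"
| "comb n (v # vs) w = w n *s v + comb (n + 1) vs w"

lemma comb_add: "comb n vs (\<lambda>m. w m + w' m) = comb n vs w + comb n vs w'"
  by (induction vs arbitrary: n) (simp_all add: algebra_simps)

lemma comb_scale: "comb n vs (\<lambda>m. c * w m) = c *s comb n vs w"
  by (induction vs arbitrary: n) (simp_all add: algebra_simps)

lemma comb_cong:
  assumes "\<And>m. m \<in> {n..<n + length vs} \<Longrightarrow> w m = w' m"
  shows "comb n vs w = comb n vs w'"
  using assms by (induction vs arbitrary: n) auto

lemma comb_in_span: "comb n vs w \<in> span (set vs)"
proof (induction vs arbitrary: n)
  case (Cons v vs)
  have "comb (n + 1) vs w \<in> span (set (v # vs))"
    using Cons span_mono[of "set vs" "set (v # vs)"] by auto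
  then show ?case by (simp add: span_add span_scale span_base)
qed (simp add: span_zero)

lemma comb_inject:
  assumes "comb n vs w = comb n vs w'" and "independent (set vs)" and "distinct vs"
    and "m \<in> {n..<n + length vs}"
  shows "w m = w' m"
  using assms
proof (induction vs arbitrary: n)
  case (Cons v vs)
  have ind: "independent (set vs)" and v: "v \<notin> span (set vs)"
    using Cons.prems(2,3) by (simp_all add: independent_insert)
  have "(w n - w' n) *s v = comb (n + 1) vs w' - comb (n + 1) vs w"
    using Cons.prems(1) by (simp add: algebra_simps)
  then have "(w n - w' n) *s v \<in> span (set vs)"
    by (simp add: span_diff comb_in_span)
  then have n: "w n = w' n"
    using v span_scale[of "(w n - w' n) *s v" "set vs" "1 / (w n - w' n)"]
    by (cases "w n - w' n = 0") simp_all
  then have "comb (n + 1) vs w = comb (n + 1) vs w'" using Cons.prems(1) by simp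
  then have "w m = w' m" if "m \<in> {n + 1..<n + 1 + length vs}"
    using Cons.IH[of "n + 1"] ind Cons.prems(3) that by simp
  then show ?case using n Cons.prems(4) by (cases "m = n") auto
qed simp

lemma comb_surj:
  assumes "x \<in> span (set vs)"
  obtains w where "comb n vs w = x" "\<And>m. m \<notin> {n..<n + length vs} \<Longrightarrow> w m = 0"
  using assms
proof (induction vs arbitrary: n x thesis)
  case Nil
  then show ?case using Nil.prems(1)[of "\<lambda>_. 0"] by simp
next
  case (Cons v vs)
  obtain k where k: "x - k *s v \<in> span (set vs)"
    using Cons.prems(2) span_breakdown_eq by auto
  obtain w where w: "comb (n + 1) vs w = x - k *s v"
    "\<And>m. m \<notin> {n + 1..<n + 1 + length vs} \<Longrightarrow> w m = 0"
    using Cons.IH[OF _ k] by blast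
  have "comb (n + 1) vs (w(n := k)) = comb (n + 1) vs w"
    by (rule comb_cong) auto
  then have "comb n (v # vs) (w(n := k)) = x" using w(1) by simp
  moreover have "(w(n := k)) m = 0" if "m \<notin> {n..<n + length (v # vs)}" for m
    using w(2)[of m] that by auto
  ultimately show ?case by (rule Cons.prems(1))
qed

end

section \<open>Coordinate algebras and their tables\<close>

lemma e_apply: "e k m = (if m = k then 1 else 0)"
  by (simp add: e_def)

definition coordinate_space :: "nat set \<Rightarrow> (nat \<Rightarrow> complex) set" where
  "coordinate_space S = {x. \<forall>m. m \<notin> S \<longrightarrow> x m = 0}"

definition pointwise :: "complex \<Rightarrow> (nat \<Rightarrow> complex) \<Rightarrow> nat \<Rightarrow> complex" where
  "pointwise c x = (\<lambda>m. c * x m)"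

lemma pointwise_apply: "pointwise c x m = c * x m"
  by (simp add: pointwise_def)

lemma vector_space_pointwise: "vector_space pointwise"
  by unfold_locales (auto simp: algebra_simps fun_eq_iff pointwise_apply)

interpretation pointwise: vector_space pointwise
  by (rule vector_space_pointwise)

lemma subspace_coordinate_space: "pointwise.subspace (coordinate_space S)"
  by (auto simp: pointwise.subspace_def coordinate_space_def pointwise_apply)

lemma span_unit_vectors:
  assumes "finite S"
  shows "pointwise.span (e ` S) = coordinate_space S"
proof (rule antisym)
  show "pointwise.span (e ` S) \<subseteq> coordinate_space S"
    by (rule pointwise.span_minimal[OF _ subspace_coordinate_space]) (auto simp: coordinate_space_def e_apply pointwise_apply)
  show "coordinate_space S \<subseteq> pointwise.span (e ` S)"
  proof
    fix x assume x: "x \<in> coordinate_space S"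
    have "(\<Sum>k\<in>S. pointwise (x k) (e k)) m = x m" for m
    proof -
      have "(\<Sum>k\<in>S. pointwise (x k) (e k)) m = (\<Sum>k\<in>S. if m = k then x k else 0)"
        by (induction rule: infinite_finite_induct) (auto simp: e_apply pointwise_apply)
      then show ?thesis using assms x by (auto simp: sum.delta' coordinate_space_def)
    qed
    then have "x = (\<Sum>k\<in>S. pointwise (x k) (e k))" by (simp add: fun_eq_iff)
    also have "\<dots> \<in> pointwise.span (e ` S)"
      by (intro pointwise.span_sum pointwise.span_scale pointwise.span_base) simp
    finally show "x \<in> pointwise.span (e ` S)" .
  qed
qed

lemma independent_unit_vectors:
  assumes "finite S"
  shows "pointwise.independent (e ` S)"
  using assms
proof (induction S)
  case (insert k S)
  have "e k \<notin> pointwise.span (e ` S)"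
    using insert by (auto simp: span_unit_vectors coordinate_space_def e_apply pointwise_apply)
  with insert show ?case by (simp add: pointwise.independent_insertI)
qed (simp add: pointwise.independent_empty)

lemma dim_coordinate_space:
  assumes "finite S"
  shows "pointwise.dim (coordinate_space S) = card S"
proof -
  have "inj_on e S"
    by (rule inj_onI) (metis e_apply zero_neq_one)
  then show ?thesis
    using pointwise.dim_span_eq_card_independent[OF independent_unit_vectors[OF assms]]
    by (simp add: span_unit_vectors assms card_image)
qed

lemma fd_space_coordinate_space:
  assumes "finite S" and "vecs W = coordinate_space S" and "scl W = pointwise"
  shows "fd_space W"
  unfolding fd_space_def assms(2,3)
  using vector_space_pointwise subspace_coordinate_space span_unit_vectors[OF assms(1)] assms(1)
  by blast

lemma vecs_table_alg: "vecs (table_alg n T) = coordinate_space {1..n}"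
  and scl_table_alg: "scl (table_alg n T) = pointwise"
  by (simp_all add: table_alg_def coordinate_space_def fun_eq_iff pointwise_apply)

lemma cdim_table_alg: "cdim (table_alg n T) = n"
  by (simp add: cdim_def vecs_table_alg scl_table_alg dim_coordinate_space)

definition entry :: "(nat \<times> nat \<times> (nat \<Rightarrow> complex)) list \<Rightarrow> nat \<Rightarrow> nat \<Rightarrow> nat \<Rightarrow> complex" where
  "entry T j k m = (\<Sum>(j', k', v)\<leftarrow>T. if j' = j \<and> k' = k then v m else 0)"

text \<open>
  The tables of extensions of \<open>N1\<close> by \<open>\<langle>e\<^sub>4, \<dots>, e\<^sub>n\<rangle>\<close>. Besides the products of \<open>N1\<close> itself, they may only
  contain the five entries of a quintuple; the symmetric part of \<open>e\<^sub>1 e\<^sub>2\<close> is recorded entirely in the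
  entry \<open>(1, 2)\<close>, leaving \<open>e\<^sub>2 e\<^sub>1 = - e\<^sub>3\<close>.
\<close>

definition N1_table :: "nat \<Rightarrow> (nat \<times> nat \<times> (nat \<Rightarrow> complex)) list \<Rightarrow> bool" where
  "N1_table n T \<longleftrightarrow>
     (\<forall>(j, k, v)\<in>set T. (j, k) \<in> {(1, 1), (1, 2), (2, 1), (2, 2), (1, 3), (2, 3)}) \<and>
     (\<forall>m. entry T 2 1 m = - e 3 m) \<and>
     (\<forall>m. m \<notin> {4..n} \<longrightarrow> entry T 1 1 m = 0 \<and> entry T 1 2 m = e 3 m \<and> entry T 2 2 m = 0
        \<and> entry T 1 3 m = 0 \<and> entry T 2 3 m = 0)"

lemma prd_N1_table:
  assumes "N1_table n T"
  shows "prd (table_alg k T) x y m = x 1 * y 1 * entry T 1 1 m + x 1 * y 2 * entry T 1 2 m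
    - x 2 * y 1 * e 3 m + x 2 * y 2 * entry T 2 2 m + x 1 * y 3 * entry T 1 3 m
    + x 2 * y 3 * entry T 2 3 m"
proof -
  have T: "\<forall>(j, k, v)\<in>set T. (j, k) \<in> {(1, 1), (1, 2), (2, 1), (2, 2), (1, 3), (2, 3)}"
    and e3: "e 3 m = - entry T 2 1 m"
    using assms by (simp_all add: N1_table_def)
  show ?thesis
    unfolding e3 using T
  proof (induction T)
    case Nil
    then show ?case by (simp add: table_alg_def entry_def)
  next
    case (Cons t T)
    obtain j k' v where t: "t = (j, k', v)" by (cases t)
    show ?case
      using Cons unfolding t
      by (auto simp: table_alg_def entry_def algebra_simps)
  qed
qed

lemma isomorphic_alg_sym:
  assumes "isomorphic_alg A B"
    and closed: "\<And>x y. x \<in> vecs A \<Longrightarrow> y \<in> vecs A \<Longrightarrow> x + y \<in> vecs A"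
      "\<And>c x. x \<in> vecs A \<Longrightarrow> scl A c x \<in> vecs A"
      "\<And>x y. x \<in> vecs A \<Longrightarrow> y \<in> vecs A \<Longrightarrow> prd A x y \<in> vecs A"
  shows "isomorphic_alg B A"
proof -
  obtain f where lin: "linear_map A B f" and bij: "bij_betw f (vecs A) (vecs B)"
    and mult: "\<And>x y. x \<in> vecs A \<Longrightarrow> y \<in> vecs A \<Longrightarrow> f (prd A x y) = prd B (f x) (f y)"
    using assms(1) by (auto simp: isomorphic_alg_def)
  let ?g = "inv_into (vecs A) f"
  have g: "?g y \<in> vecs A" "f (?g y) = y" if "y \<in> vecs B" for y
    using bij that by (auto simp: bij_betw_def inv_into_into f_inv_into_f)
  have gI: "?g y = x" if "x \<in> vecs A" "f x = y" for x y
    using bij that by (auto simp: bij_betw_def)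
  have "linear_map B A ?g"
    unfolding linear_map_def
    using lin g closed by (intro conjI ballI allI gI) (auto simp: linear_map_def)
  moreover have "?g (prd B x y) = prd A (?g x) (?g y)" if "x \<in> vecs B" "y \<in> vecs B" for x y
    using g that closed mult by (intro gI) auto
  ultimately show ?thesis
    using bij_betw_inv_into[OF bij] unfolding isomorphic_alg_def by blast
qed

lemma isomorphic_alg_trans:
  assumes "isomorphic_alg A B" and "isomorphic_alg B C"
  shows "isomorphic_alg A C"
proof -
  obtain f g where "linear_map A B f" "bij_betw f (vecs A) (vecs B)"
    "\<forall>x\<in>vecs A. \<forall>y\<in>vecs A. f (prd A x y) = prd B (f x) (f y)"
    "linear_map B C g" "bij_betw g (vecs B) (vecs C)"
    "\<forall>x\<in>vecs B. \<forall>y\<in>vecs B. g (prd B x y) = prd C (g x) (g y)"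
    using assms unfolding isomorphic_alg_def by blast
  then show ?thesis
    unfolding isomorphic_alg_def
    by (intro exI[of _ "g \<circ> f"]) (auto simp: linear_map_def intro: bij_betw_trans)
qed

section \<open>The cocycles of N1\<close>

lemma vecs_N1: "vecs N1 = coordinate_space {1..3}"
  and scl_N1: "scl N1 = pointwise"
  by (simp_all add: N1_def vecs_table_alg scl_table_alg)

lemma prd_N1: "prd N1 x y = pointwise (x 1 * y 2 - x 2 * y 1) (e 3)"
  by (simp add: N1_def table_alg_def fun_eq_iff pointwise_apply algebra_simps)

lemma in_N1_iff: "x \<in> vecs N1 \<longleftrightarrow> (\<forall>m. m \<noteq> 1 \<and> m \<noteq> 2 \<and> m \<noteq> 3 \<longrightarrow> x m = 0)"
proof -
  have "m \<in> {1..3} \<longleftrightarrow> m = 1 \<or> m = 2 \<or> m = 3" for m :: nat by auto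
  then show ?thesis by (auto simp: vecs_N1 coordinate_space_def)
qed

lemma N1_decompose:
  assumes "x \<in> vecs N1"
  shows "x = pointwise (x 1) (e 1) + (pointwise (x 2) (e 2) + pointwise (x 3) (e 3))"
  using assms by (auto simp: fun_eq_iff in_N1_iff e_apply pointwise_apply)

lemma N1_closed:
  "pointwise c (e 1) \<in> vecs N1" "pointwise c (e 2) \<in> vecs N1" "pointwise c (e 3) \<in> vecs N1"
  "e 1 \<in> vecs N1" "e 2 \<in> vecs N1" "e 3 \<in> vecs N1"
  "x \<in> vecs N1 \<Longrightarrow> y \<in> vecs N1 \<Longrightarrow> x + y \<in> vecs N1"
  by (auto simp: in_N1_iff e_apply pointwise_apply)

locale N1_extension =
  fixes V :: "'v::ab_group_add cspace"
    and \<theta> :: "(nat \<Rightarrow> complex) \<Rightarrow> (nat \<Rightarrow> complex) \<Rightarrow> 'v"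
  assumes fd_V: "fd_space V" and cocycle: "\<theta> \<in> cocycles N1 V"
begin

sublocale quadratic_data "scl V" "\<theta> (e 1) (e 1)" "\<theta> (e 1) (e 2) + \<theta> (e 2) (e 1)" "\<theta> (e 2) (e 2)"
  "\<theta> (e 1) (e 3)" "\<theta> (e 2) (e 3)"
proof -
  interpret vector_space "scl V" using fd_V by (simp add: fd_space_def)
  show "quadratic_data (scl V)" by unfold_locales
qed

abbreviation B where "B \<equiv> central_ext N1 V \<theta>"

lemma \<theta>_in_V: "x \<in> vecs N1 \<Longrightarrow> y \<in> vecs N1 \<Longrightarrow> \<theta> x y \<in> vecs V"
  using cocycle by (auto simp: cocycles_def bilinear_map_def linear_map_def)

lemma subspace_V: "subspace (vecs V)"
  using fd_V by (simp add: fd_space_def)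

lemma \<theta>_bilinear:
  assumes "x \<in> vecs N1" "z \<in> vecs N1"
  shows "y \<in> vecs N1 \<Longrightarrow> \<theta> (x + y) z = \<theta> x z + \<theta> y z"
    "y \<in> vecs N1 \<Longrightarrow> \<theta> z (x + y) = \<theta> z x + \<theta> z y"
    "\<theta> (pointwise c x) z = scl V c (\<theta> x z)" "\<theta> z (pointwise c x) = scl V c (\<theta> z x)"
  using cocycle assms by (auto simp: cocycles_def bilinear_map_def linear_map_def scl_N1)

text \<open>
  \<open>e\<^sub>3 = e\<^sub>1 e\<^sub>2\<close>, and \<open>e\<^sub>2 z + z e\<^sub>2 = 0\<close> in the anticommutative algebra \<open>N1\<close>.
\<close>

lemma \<theta>_e3_left:
  assumes "z \<in> vecs N1"
  shows "\<theta> (e 3) z = 0"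
proof -
  have "prd N1 (e 1) (e 2) = e 3" by (simp add: prd_N1 fun_eq_iff e_apply pointwise_apply)
  moreover have "\<theta> (prd N1 (e 1) (e 2)) z = \<theta> (e 1) (prd N1 (e 2) z + prd N1 z (e 2))"
    using cocycle assms N1_closed by (auto simp: cocycles_def)
  moreover have "prd N1 (e 2) z + prd N1 z (e 2) = pointwise 0 (e 1)"
    using assms by (simp add: prd_N1 fun_eq_iff e_apply pointwise_apply)
  ultimately show ?thesis using \<theta>_bilinear(4)[of "e 1" "e 1" 0] N1_closed by simp
qed

lemma \<theta>_expand:
  assumes "x \<in> vecs N1" "y \<in> vecs N1"
  shows "\<theta> x y = scl V (x 1 * y 1) (\<theta> (e 1) (e 1)) + scl V (x 1 * y 2) (\<theta> (e 1) (e 2))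
    + scl V (x 2 * y 1) (\<theta> (e 2) (e 1)) + scl V (x 2 * y 2) (\<theta> (e 2) (e 2))
    + scl V (x 1 * y 3) (\<theta> (e 1) (e 3)) + scl V (x 2 * y 3) (\<theta> (e 2) (e 3))"
  by (subst N1_decompose[OF assms(1)], subst N1_decompose[OF assms(2)])
    (simp add: \<theta>_bilinear N1_closed \<theta>_e3_left algebra_simps del: One_nat_def)

end

section \<open>Splitting off the annihilator\<close>

context complex_space
begin

lemma separating_functional:
  assumes "v \<notin> span S"
  obtains h :: "'v \<Rightarrow> complex" where "\<And>x y. h (x + y) = h x + h y" "\<And>c x. h (c *s x) = c * h x"
    "\<And>x. x \<in> span S \<Longrightarrow> h x = 0" "h v = 1"
proof -
  obtain C where C: "C \<subseteq> S" "independent C" "S \<subseteq> span C"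
    using maximal_independent_subset by blast
  have span: "span C = span S" using C(1,3) by (simp add: span_eq span_superset subset_trans)
  have v: "v \<notin> C" "v \<notin> span C" using assms span by (auto dest: span_base)
  have ind: "independent (insert v C)" using C(2) v(2) by (rule independent_insertI[rotated])
  define E where "E = extend_basis (insert v C)"
  have E: "independent E" "insert v C \<subseteq> E" "\<And>x. x \<in> span E"
    using ind extend_basis_superset[OF ind] by (auto simp: E_def independent_extend_basis)
  define h where "h x = representation E x v" for x
  show ?thesis
  proof (rule that[of h])
    show "h v = 1" using E(2) by (simp add: h_def representation_basis[OF E(1)])
    fix x assume "x \<in> span S"
    then have "representation E x = representation C x"
      using E(2) by (intro representation_extend[OF E(1)]) (auto simp: span)
    then show "h x = 0" using v(1) representation_ne_zero[of C x v] by (auto simp: h_def)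
  qed (simp_all add: h_def representation_add[OF E(1) E(3) E(3)] representation_scale[OF E(1) E(3)])
qed

end

lemma vector_space_product:
  assumes "vector_space s" and "vector_space s'"
  shows "vector_space (\<lambda>c (x, x'). (s c x, s' c x'))"
proof -
  interpret a: vector_space s by (fact assms(1))
  interpret b: vector_space s' by (fact assms(2))
  show ?thesis by unfold_locales (auto simp: algebra_simps)
qed

context N1_extension
begin

lemma module_B: "module (scl B)"
proof -
  have "vector_space (scl B)"
    unfolding central_ext_def
    using vector_space_product[OF vector_space_pointwise vector_space_axioms] by (simp add: scl_N1)
  then show ?thesis by (simp add: vector_space_def module_def)
qed

lemma value_space_subset: "value_space \<subseteq> vecs V"
  by (rule span_minimal[OF _ subspace_V]) (simp add: \<theta>_in_V N1_closed subspace_add[OF subspace_V] del: One_nat_def)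

text \<open>
  If the five vectors do not span \<open>V\<close>, some functional \<open>h\<close> vanishes on them but not on \<open>V\<close>. Then
  \<open>h(\<theta>(x, y)) = k (x\<^sub>1 y\<^sub>2 - x\<^sub>2 y\<^sub>1)\<close> is \<open>k\<close> times the third coordinate of the product \<open>x y\<close>. Hence
  \<open>{(x, v). h v = k x\<^sub>3}\<close> contains all products of the extension; it is an ideal, and a line in \<open>V\<close> on
  which \<open>h\<close> does not vanish is a complementary annihilator component.
\<close>

lemma non_split_spans:
  assumes "non_split B"
  shows "value_space = vecs V"
proof (rule ccontr)
  assume "value_space \<noteq> vecs V"
  then obtain v0 where v0: "v0 \<in> vecs V" "v0 \<notin> value_space"
    using value_space_subset by blast
  obtain h where h_add: "\<And>x y. h (x + y) = h x + h y" and h_scale: "\<And>c x. h (scl V c x) = c * h x"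
    and h0: "\<And>x. x \<in> value_space \<Longrightarrow> h x = 0" and h1: "h v0 = 1"
    using separating_functional[OF v0(2)] by blast
  have hz: "h 0 = 0" using h_scale[of 0 0] by simp
  define k where "k = h (\<theta> (e 1) (e 2))"
  have h\<theta>: "h (\<theta> x y) = (x 1 * y 2 - x 2 * y 1) * k" if "x \<in> vecs N1" "y \<in> vecs N1" for x y
  proof -
    have "h (\<theta> (e 1) (e 2)) + h (\<theta> (e 2) (e 1)) = 0"
      using h0[of "\<theta> (e 1) (e 2) + \<theta> (e 2) (e 1)"] by (simp add: h_add span_base del: One_nat_def)
    then have "h (\<theta> (e 2) (e 1)) = - k" by (simp add: k_def add_eq_0_iff)
    moreover have "h (\<theta> (e 1) (e 1)) = 0" "h (\<theta> (e 2) (e 2)) = 0"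
      "h (\<theta> (e 1) (e 3)) = 0" "h (\<theta> (e 2) (e 3)) = 0"
      by (intro h0 span_base; simp)+
    ultimately show ?thesis
      by (simp add: \<theta>_expand[OF that] h_add h_scale algebra_simps del: One_nat_def flip: k_def)
  qed
  define I where "I = {(0 :: nat \<Rightarrow> complex, scl V c v0) | c. True}"
  define B0 where "B0 = {(x, v). x \<in> vecs N1 \<and> v \<in> vecs V \<and> h v = x 3 * k}"
  have N1_sub: "0 \<in> vecs N1" "pointwise c x \<in> vecs N1" if "x \<in> vecs N1" for x c
    using that by (auto simp: in_N1_iff pointwise_apply)
  have V_sub: "0 \<in> vecs V" "\<And>x y. x \<in> vecs V \<Longrightarrow> y \<in> vecs V \<Longrightarrow> x + y \<in> vecs V"
    "\<And>x c. x \<in> vecs V \<Longrightarrow> scl V c x \<in> vecs V"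
    using subspace_V by (auto simp: subspace_def)
  have zero: "0 \<in> vecs N1" by (simp add: in_N1_iff)
  have zero_pw: "pointwise c 0 = 0" for c by (simp add: fun_eq_iff pointwise_apply)
  have prd0: "\<theta> 0 y = 0" "\<theta> y 0 = 0" "prd N1 0 y = 0" "prd N1 y 0 = 0" if "y \<in> vecs N1" for y
    using \<theta>_expand[OF zero that] \<theta>_expand[OF that zero]
    by (simp_all add: prd_N1 fun_eq_iff pointwise_apply)
  have subI: "subspace_of I B"
    unfolding subspace_of_def module.subspace_def[OF module_B]
  proof (intro conjI ballI allI)
    show "0 \<in> I" unfolding I_def by (auto simp: zero_prod_def intro!: exI[of _ 0])
    show "x + y \<in> I" if "x \<in> I" "y \<in> I" for x y
      using that unfolding I_def by (auto simp: scale_left_distrib[symmetric])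
    show "scl B c x \<in> I" if "x \<in> I" for c x
      using that unfolding I_def by (auto simp: central_ext_def scl_N1 zero_pw)
    show "I \<subseteq> vecs B" using zero v0(1) V_sub(3) by (auto simp: I_def central_ext_def)
  qed
  have subB0: "subspace_of B0 B"
    unfolding subspace_of_def module.subspace_def[OF module_B]
    using N1_sub[OF zero] N1_sub(2) N1_closed(7) V_sub
    by (auto simp: B0_def zero_prod_def hz h_add h_scale central_ext_def scl_N1 algebra_simps pointwise_apply)
  have prdB0: "prd B x y \<in> B0" if "x \<in> vecs B" "y \<in> vecs B" for x y
    using that \<theta>_in_V
    by (auto simp: B0_def central_ext_def h\<theta> prd_N1 pointwise_apply e_apply N1_closed)
  have "ideal_of B0 B"
    unfolding ideal_of_def using subB0 prdB0 by (auto simp: subspace_of_def)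
  moreover have annI: "prd B x y = 0 \<and> prd B y x = 0" if "x \<in> I" "y \<in> vecs B" for x y
    using that by (auto simp: I_def central_ext_def prd0 zero_prod_def)
  then have "ideal_of I B"
    using subI by (auto simp: ideal_of_def subspace_of_def module.subspace_def[OF module_B])
  moreover have "I \<subseteq> Ann B"
    using subI annI by (auto simp: Ann_def subspace_of_def)
  moreover have "I \<noteq> {0}"
  proof -
    have "(0, v0) \<in> I" by (auto simp: I_def intro!: exI[of _ 1])
    then show ?thesis using h1 hz by (auto simp: zero_prod_def)
  qed
  moreover have "B0 \<inter> I = {0}"
  proof -
    have "c = 0" if "h (scl V c v0) = 0" for c using that h1 by (simp add: h_scale)
    then have "p = 0" if "p \<in> B0" "p \<in> I" for p
      using that by (auto simp: B0_def I_def zero_prod_def)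
    moreover have "0 \<in> B0" "0 \<in> I"
      using subI subB0 by (auto simp: subspace_of_def module.subspace_def[OF module_B])
    ultimately show ?thesis by auto
  qed
  moreover have "vecs B = {x + y | x y. x \<in> B0 \<and> y \<in> I}"
  proof (intro set_eqI iffI)
    fix p assume "p \<in> vecs B"
    then obtain x v where p: "p = (x, v)" "x \<in> vecs N1" "v \<in> vecs V"
      by (auto simp: central_ext_def)
    define c where "c = h v - x 3 * k"
    have "(x, v + scl V (- c) v0) \<in> B0"
      using p V_sub v0(1) by (auto simp: B0_def h_add h_scale h1 c_def simp del: scale_minus_left)
    moreover have "p = (x, v + scl V (- c) v0) + (0, scl V c v0)"
      by (simp add: p(1))
    ultimately show "p \<in> {x + y | x y. x \<in> B0 \<and> y \<in> I}"
      unfolding I_def by blast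
  next
    fix p assume "p \<in> {x + y | x y. x \<in> B0 \<and> y \<in> I}"
    then show "p \<in> vecs B"
      using v0(1) V_sub by (auto simp: B0_def I_def central_ext_def)
  qed
  ultimately have "annihilator_component I B"
    using subI unfolding annihilator_component_def by blast
  then show False using assms by (auto simp: non_split_def)
qed

section \<open>The table of an adapted basis\<close>

text \<open>
  The basis belonging to an attained quintuple consists of its generators \<open>u, v\<close>, of \<open>- v u\<close> and of the
  list \<open>vs\<close>. With this third vector all of \<open>\<theta>(u, v) + \<theta>(v, u)\<close> appears in the product \<open>u v\<close>. The proof
  writes down the linear map from the table algebra that sends \<open>e\<^sub>1, \<dots>, e\<^sub>n\<close> to this basis.
\<close>

lemma isomorphic_table_alg:
  assumes at: "attained p11 p12 p22 m1 m2" and T: "N1_table n T" and n: "n = 3 + length vs"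
    and vs: "independent (set vs)" "distinct vs" "span (set vs) = vecs V"
    and p: "comb 4 vs (entry T 1 1) = p11" "comb 4 vs (entry T 1 2) = p12"
      "comb 4 vs (entry T 2 2) = p22" "comb 4 vs (entry T 1 3) = m1" "comb 4 vs (entry T 2 3) = m2"
  shows "isomorphic_alg B (table_alg n T)"
proof (rule isomorphic_alg_sym)
  obtain a b c d s t where D: "a * d - b * c \<noteq> 0" and q:
     "p11 = scl V (a\<^sup>2) (\<theta> (e 1) (e 1)) + scl V (a * b) (\<theta> (e 1) (e 2) + \<theta> (e 2) (e 1))
       + scl V (b\<^sup>2) (\<theta> (e 2) (e 2)) + scl V (s * a) (\<theta> (e 1) (e 3)) + scl V (s * b) (\<theta> (e 2) (e 3))"
     "p12 = scl V (2 * a * c) (\<theta> (e 1) (e 1)) + scl V (a * d + b * c) (\<theta> (e 1) (e 2) + \<theta> (e 2) (e 1))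
       + scl V (2 * b * d) (\<theta> (e 2) (e 2)) + scl V (t * a + s * c) (\<theta> (e 1) (e 3))
       + scl V (t * b + s * d) (\<theta> (e 2) (e 3))"
     "p22 = scl V (c\<^sup>2) (\<theta> (e 1) (e 1)) + scl V (c * d) (\<theta> (e 1) (e 2) + \<theta> (e 2) (e 1))
       + scl V (d\<^sup>2) (\<theta> (e 2) (e 2)) + scl V (t * c) (\<theta> (e 1) (e 3)) + scl V (t * d) (\<theta> (e 2) (e 3))"
     "m1 = scl V ((a * d - b * c) * a) (\<theta> (e 1) (e 3)) + scl V ((a * d - b * c) * b) (\<theta> (e 2) (e 3))"
     "m2 = scl V ((a * d - b * c) * c) (\<theta> (e 1) (e 3)) + scl V ((a * d - b * c) * d) (\<theta> (e 2) (e 3))"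
    using at unfolding attained_def by blast
  let ?D = "a * d - b * c" and ?A = "table_alg n T"
  \<comment> \<open>the value of \<open>\<theta>\<close> at the second and the first generator\<close>
  define \<tau> where "\<tau> = scl V (a * c) (\<theta> (e 1) (e 1)) + scl V (b * c) (\<theta> (e 1) (e 2))
    + scl V (a * d) (\<theta> (e 2) (e 1)) + scl V (b * d) (\<theta> (e 2) (e 2))
    + scl V (c * s) (\<theta> (e 1) (e 3)) + scl V (d * s) (\<theta> (e 2) (e 3))"
  define X :: "(nat \<Rightarrow> complex) \<Rightarrow> nat \<Rightarrow> complex" where
    "X x = (\<lambda>m. if m = 1 then a * x 1 + c * x 2 else if m = 2 then b * x 1 + d * x 2
            else if m = 3 then s * x 1 + t * x 2 + ?D * x 3 else 0)" for x
  have X: "X x 1 = a * x 1 + c * x 2" "X x 2 = b * x 1 + d * x 2"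
    "X x 3 = s * x 1 + t * x 2 + ?D * x 3" "X x \<in> vecs N1" for x
    by (simp_all add: X_def in_N1_iff)
  define F where "F x = (X x, comb 4 vs x - scl V (x 3) \<tau>)" for x
  have \<tau>_in_V: "\<tau> \<in> vecs V"
    unfolding \<tau>_def by (intro subspace_add[OF subspace_V] subspace_scale[OF subspace_V] \<theta>_in_V N1_closed)
  have F_in_B: "F x \<in> vecs B" for x
    using X(4) comb_in_span[of 4 vs x] \<tau>_in_V unfolding vs(3)
    by (simp add: F_def central_ext_def subspace_diff[OF subspace_V] subspace_scale[OF subspace_V])
  have prd_comb: "comb 4 vs (prd ?A x y) = scl V (x 1 * y 1) p11 + scl V (x 1 * y 2) p12
      + scl V (x 2 * y 2) p22 + scl V (x 1 * y 3) m1 + scl V (x 2 * y 3) m2" for x y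
  proof -
    have "comb 4 vs (prd ?A x y) = comb 4 vs (\<lambda>m. x 1 * y 1 * entry T 1 1 m + x 1 * y 2 * entry T 1 2 m
      + x 2 * y 2 * entry T 2 2 m + x 1 * y 3 * entry T 1 3 m + x 2 * y 3 * entry T 2 3 m)"
      by (rule comb_cong) (simp add: prd_N1_table[OF T] e_apply)
    then show ?thesis by (simp add: comb_add comb_scale p del: One_nat_def)
  qed
  have prd_low: "prd ?A x y 1 = 0" "prd ?A x y 2 = 0" "prd ?A x y 3 = x 1 * y 2 - x 2 * y 1" for x y
    using T by (simp_all add: prd_N1_table[OF T] N1_table_def e_apply del: One_nat_def)
  have prd_closed: "prd ?A x y \<in> vecs ?A" for x y
    using T n by (auto simp: prd_N1_table[OF T] vecs_table_alg coordinate_space_def N1_table_def e_apply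
        simp del: One_nat_def)
  have mult: "F (prd ?A x y) = prd B (F x) (F y)" for x y
  proof -
    have "X (prd ?A x y) = prd N1 (X x) (X y)"
      by (simp add: fun_eq_iff X_def[of "prd ?A x y"] prd_low prd_N1 X pointwise_apply e_apply
          algebra_simps del: One_nat_def)
    moreover have "comb 4 vs (prd ?A x y) - scl V (prd ?A x y 3) \<tau> = \<theta> (X x) (X y)"
      unfolding prd_comb \<theta>_expand[OF X(4) X(4)] X prd_low q \<tau>_def
      by (rule vec_eqI)
        (simp add: coord_simps algebra_simps power2_eq_square del: One_nat_def)
    ultimately show ?thesis by (simp add: F_def central_ext_def)
  qed
  have lin: "linear_map ?A B F"
    using F_in_B
    by (auto simp: linear_map_def F_def X_def fun_eq_iff central_ext_def scl_N1 scl_table_alg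
        pointwise_apply comb_add comb_scale plus_fun_def pointwise_def algebra_simps)
  have "inj_on F (vecs ?A)"
  proof (rule inj_onI)
    fix x y assume xy: "x \<in> vecs ?A" "y \<in> vecs ?A" and "F x = F y"
    then have eq: "X x = X y" "comb 4 vs x - scl V (x 3) \<tau> = comb 4 vs y - scl V (y 3) \<tau>"
      by (simp_all add: F_def)
    have "?D * (x 1 - y 1) = d * (X x 1 - X y 1) - c * (X x 2 - X y 2)"
      "?D * (x 2 - y 2) = a * (X x 2 - X y 2) - b * (X x 1 - X y 1)"
      unfolding X by (simp_all add: algebra_simps)
    then have 12: "x 1 = y 1" "x 2 = y 2" using D eq(1) by simp_all
    then have 3: "x 3 = y 3" using X(3)[of x] X(3)[of y] D eq(1) by simp
    then have "comb 4 vs x = comb 4 vs y" using eq(2) by simp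
    then have "x m = y m" if "m \<in> {4..<4 + length vs}" for m
      using comb_inject vs(1,2) that by blast
    moreover have "m = 1 \<or> m = 2 \<or> m = 3 \<or> m \<in> {4..<4 + length vs} \<or> m \<notin> {1..n}" for m
      unfolding n by auto
    ultimately show "x = y"
      using xy 12 3 by (auto simp: fun_eq_iff vecs_table_alg coordinate_space_def) metis
  qed
  moreover have "F ` vecs ?A = vecs B"
  proof (intro equalityI subsetI)
    fix p assume "p \<in> vecs B"
    then obtain y v where y: "p = (y, v)" "y \<in> vecs N1" "v \<in> vecs V" by (auto simp: central_ext_def)
    define x1 where "x1 = (d * y 1 - c * y 2) / ?D"
    define x2 where "x2 = (a * y 2 - b * y 1) / ?D"
    define x3 where "x3 = (y 3 - s * x1 - t * x2) / ?D"
    have x12: "?D * x1 = d * y 1 - c * y 2" "?D * x2 = a * y 2 - b * y 1"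
      using D by (simp_all add: x1_def x2_def)
    have "?D * (a * x1 + c * x2) = ?D * y 1" "?D * (b * x1 + d * x2) = ?D * y 2"
      using x12 by algebra+
    then have sol: "a * x1 + c * x2 = y 1" "b * x1 + d * x2 = y 2" "s * x1 + t * x2 + ?D * x3 = y 3"
      using D by (simp_all add: x3_def)
    have "v + scl V x3 \<tau> \<in> span (set vs)"
      using y(3) \<tau>_in_V by (simp add: vs(3) subspace_add[OF subspace_V] subspace_scale[OF subspace_V])
    then obtain w where w: "comb 4 vs w = v + scl V x3 \<tau>" "\<And>m. m \<notin> {4..<4 + length vs} \<Longrightarrow> w m = 0"
      using comb_surj by blast
    define x where "x = w(1 := x1, 2 := x2, 3 := x3)"
    have "comb 4 vs x = comb 4 vs w" by (rule comb_cong) (simp add: x_def)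
    moreover have "X x = y"
      using y(2) sol by (auto simp: fun_eq_iff X_def x_def in_N1_iff)
    ultimately have "F x = p" by (simp add: F_def y w(1) x_def)
    moreover have "x \<in> vecs ?A"
      using w(2) by (auto simp: vecs_table_alg coordinate_space_def x_def n)
    ultimately show "p \<in> F ` vecs ?A" by blast
  qed (use F_in_B in auto)
  ultimately show "isomorphic_alg ?A B"
    unfolding isomorphic_alg_def bij_betw_def using lin mult by blast
  show "x + y \<in> vecs ?A" if "x \<in> vecs ?A" "y \<in> vecs ?A" for x y
    using that by (auto simp: vecs_table_alg coordinate_space_def)
  show "scl ?A c x \<in> vecs ?A" if "x \<in> vecs ?A" for c x
    using that by (auto simp: vecs_table_alg scl_table_alg coordinate_space_def pointwise_apply)
  show "prd ?A x y \<in> vecs ?A" for x y by (rule prd_closed)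
qed

end

lemma zinbiel_zero_product: "zinbiel (table_alg n [])"
proof -
  have "fd_space (table_alg n [])"
    by (rule fd_space_coordinate_space[of "{1..n}"]) (simp_all add: vecs_table_alg scl_table_alg)
  moreover have "prd (table_alg n []) x y = 0" for x y
    by (simp add: table_alg_def fun_eq_iff)
  moreover have "pointwise c 0 = 0" for c
    by (simp add: fun_eq_iff pointwise_apply)
  moreover have "0 \<in> vecs (table_alg n [])"
    by (simp add: vecs_table_alg coordinate_space_def)
  ultimately show ?thesis
    by (simp add: zinbiel_def fd_algebra_def bilinear_map_def linear_map_def scl_table_alg)
qed

text \<open>
  If \<open>e\<^sub>3\<close> annihilates the whole algebra, all products lie in the span of \<open>e\<^sub>3, \<dots>, e\<^sub>n\<close>, which is
  contained in the annihilator, and the quotient by it is two-dimensional with zero product.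
\<close>

lemma central_ext_of_zero_product:
  assumes T: "N1_table n T" and "n \<ge> 3" and "\<And>m. entry T 1 3 m = 0" and "\<And>m. entry T 2 3 m = 0"
  shows "central_ext_of_dim_less 3 (table_alg n T)"
proof -
  define A where "A = table_alg 2 []"
  define W :: "(nat \<Rightarrow> complex) cspace" where "W = \<lparr>vecs = coordinate_space {3..n}, scl = pointwise\<rparr>"
  define \<phi> where "\<phi> = prd (table_alg n T)"
  have \<phi>: "\<phi> x y m = x 1 * y 1 * entry T 1 1 m + x 1 * y 2 * entry T 1 2 m
      - x 2 * y 1 * e 3 m + x 2 * y 2 * entry T 2 2 m" for x y m
    by (simp add: \<phi>_def prd_N1_table[OF T] assms(3,4) del: One_nat_def)
  have \<phi>_in_W: "\<phi> x y \<in> coordinate_space {3..n}" for x y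
  proof -
    have "\<phi> x y m = 0" if "m \<notin> {3..n}" for m
      using T that \<open>n \<ge> 3\<close> unfolding \<phi> N1_table_def by (auto simp: e_apply)
    then show ?thesis by (simp add: coordinate_space_def)
  qed
  have prd_A: "prd A x y = 0" for x y
    by (simp add: A_def table_alg_def fun_eq_iff)
  have bilinear: "bilinear_map A W \<phi>"
    by (simp add: bilinear_map_def linear_map_def A_def W_def scl_table_alg \<phi>_in_W)
      (auto simp: fun_eq_iff \<phi> pointwise_apply algebra_simps)
  have "\<phi> \<in> cocycles A W"
    using bilinear unfolding cocycles_def by (auto simp: prd_A \<phi> fun_eq_iff)
  moreover have "fd_space W"
    by (rule fd_space_coordinate_space[of "{3..n}"]) (simp_all add: W_def)
  moreover have "zinbiel A" unfolding A_def by (rule zinbiel_zero_product)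
  moreover have "cdim A < 3" by (simp add: A_def cdim_table_alg)
  moreover have "isomorphic_alg (table_alg n T) (central_ext A W \<phi>)"
    unfolding isomorphic_alg_def
  proof (intro exI[of _ "\<lambda>x. (\<lambda>m. if m \<in> {1..2} then x m else 0, \<lambda>m. if m \<in> {3..n} then x m else 0)"]
      conjI ballI)
    let ?F = "\<lambda>x :: nat \<Rightarrow> complex. (\<lambda>m. if m \<in> {1..2} then x m else 0, \<lambda>m. if m \<in> {3..n} then x m else 0)"
    show "linear_map (table_alg n T) (central_ext A W \<phi>) ?F"
      by (auto simp: linear_map_def central_ext_def A_def W_def vecs_table_alg scl_table_alg
          coordinate_space_def fun_eq_iff pointwise_apply)
    show "bij_betw ?F (vecs (table_alg n T)) (vecs (central_ext A W \<phi>))"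
    proof (rule bij_betw_byWitness[where f' = "\<lambda>(u, v). u + v"])
      show "\<forall>x\<in>vecs (table_alg n T). (case ?F x of (u, v) \<Rightarrow> u + v) = x"
        by (auto simp: vecs_table_alg coordinate_space_def fun_eq_iff)
      show "\<forall>p\<in>vecs (central_ext A W \<phi>). ?F (case p of (u, v) \<Rightarrow> u + v) = p"
        by (auto simp: central_ext_def A_def W_def vecs_table_alg coordinate_space_def fun_eq_iff)
      show "?F ` vecs (table_alg n T) \<subseteq> vecs (central_ext A W \<phi>)"
        by (auto simp: central_ext_def A_def W_def vecs_table_alg coordinate_space_def)
      show "(\<lambda>(u, v). u + v) ` vecs (central_ext A W \<phi>) \<subseteq> vecs (table_alg n T)"
        using \<open>n \<ge> 3\<close>
        by (auto simp: central_ext_def A_def W_def vecs_table_alg coordinate_space_def)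
    qed
    show "?F (prd (table_alg n T) x y) = prd (central_ext A W \<phi>) (?F x) (?F y)" for x y
    proof -
      have "(\<lambda>m. if m \<in> {1..2} then \<phi> x y m else 0) = 0"
        using \<phi>_in_W[of x y] by (auto simp: coordinate_space_def fun_eq_iff)
      moreover have "(\<lambda>m. if m \<in> {3..n} then \<phi> x y m else 0) = \<phi> x y"
        using \<phi>_in_W[of x y] by (auto simp: coordinate_space_def fun_eq_iff)
      moreover have "\<phi> (\<lambda>m. if m \<in> {1..2} then x m else 0) (\<lambda>m. if m \<in> {1..2} then y m else 0) = \<phi> x y"
        by (simp add: fun_eq_iff \<phi>)
      ultimately show ?thesis
        unfolding \<phi>_def[symmetric] by (simp add: central_ext_def prd_A)
    qed
  qed
  ultimately show ?thesis unfolding central_ext_of_dim_less_def by blast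
qed

context N1_extension
begin

lemma basis_list:
  obtains vs where "independent (set vs)" "distinct vs" "span (set vs) = vecs V"
proof -
  obtain E where E: "finite E" "span E = vecs V"
    using fd_V by (auto simp: fd_space_def)
  obtain C where C: "C \<subseteq> E" "independent C" "E \<subseteq> span C"
    using maximal_independent_subset by blast
  obtain vs where "set vs = C" "distinct vs"
    using finite_distinct_list finite_subset[OF C(1) E(1)] by metis
  moreover have "span C = vecs V"
    using C E(2) by (metis span_mono span_span subset_antisym)
  ultimately show ?thesis using that C(2) by blast
qed

text \<open>
  Otherwise the extension has a table in which \<open>e\<^sub>3\<close> lies in the annihilator.
\<close>

lemma linear_part_nonzero:
  assumes "\<not> central_ext_of_dim_less (cdim N1) B"
  shows "\<theta> (e 1) (e 3) \<noteq> 0 \<or> \<theta> (e 2) (e 3) \<noteq> 0"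
proof (rule ccontr)
  assume "\<not> ?thesis"
  then have l: "\<theta> (e 1) (e 3) = 0" "\<theta> (e 2) (e 3) = 0" by simp_all
  obtain vs where vs: "independent (set vs)" "distinct vs" "span (set vs) = vecs V"
    by (rule basis_list)
  have coords: "\<exists>w. comb 4 vs w = v \<and> (\<forall>m. m \<notin> {4..<4 + length vs} \<longrightarrow> w m = 0)" if "v \<in> vecs V" for v
    using comb_surj[of v vs 4] that vs(3) by metis
  obtain w11 where w11: "comb 4 vs w11 = \<theta> (e 1) (e 1)" "\<forall>m. m \<notin> {4..<4 + length vs} \<longrightarrow> w11 m = 0"
    using coords[of "\<theta> (e 1) (e 1)"] by (auto simp: \<theta>_in_V N1_closed simp del: One_nat_def)
  obtain w12 where w12: "comb 4 vs w12 = \<theta> (e 1) (e 2) + \<theta> (e 2) (e 1)"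
      "\<forall>m. m \<notin> {4..<4 + length vs} \<longrightarrow> w12 m = 0"
    using coords[of "\<theta> (e 1) (e 2) + \<theta> (e 2) (e 1)"]
    by (auto simp: \<theta>_in_V N1_closed subspace_add[OF subspace_V] simp del: One_nat_def)
  obtain w22 where w22: "comb 4 vs w22 = \<theta> (e 2) (e 2)" "\<forall>m. m \<notin> {4..<4 + length vs} \<longrightarrow> w22 m = 0"
    using coords[of "\<theta> (e 2) (e 2)"] by (auto simp: \<theta>_in_V N1_closed)
  define n where "n = 3 + length vs"
  define T where "T = [(1, 1, w11), (1, 2, e 3 + w12), (2, 1, - e 3), (2 :: nat, 2 :: nat, w22)]"
  have entries: "entry T 1 1 = w11" "entry T 1 2 = (\<lambda>m. e 3 m + w12 m)" "entry T 2 1 = (\<lambda>m. - e 3 m)"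
    "entry T 2 2 = w22" "entry T 1 3 = (\<lambda>m. 0)" "entry T 2 3 = (\<lambda>m. 0)"
    by (simp_all add: T_def entry_def fun_eq_iff)
  have "N1_table n T"
    unfolding N1_table_def entries
    using w11(2) w12(2) w22(2) by (auto simp: T_def n_def)
  moreover have "comb 4 vs (\<lambda>m. e 3 m + w12 m) = comb 4 vs w12"
    by (rule comb_cong) (simp add: e_apply)
  moreover have "comb 4 vs (\<lambda>m. 0) = 0"
    using comb_scale[of 4 vs 0 "\<lambda>m. 0"] by simp
  ultimately have "isomorphic_alg B (table_alg n T)"
    by (intro isomorphic_table_alg[OF attained_start _ n_def vs]) (simp_all only: entries w11 w12 w22 l)
  moreover have "central_ext_of_dim_less 3 (table_alg n T)"
    using \<open>N1_table n T\<close> by (rule central_ext_of_zero_product) (simp_all add: entries n_def del: One_nat_def)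
  ultimately have "central_ext_of_dim_less 3 B"
    unfolding central_ext_of_dim_less_def using isomorphic_alg_trans by blast
  then show False using assms by (simp add: N1_def cdim_table_alg)
qed

text \<open>
  Spanning vectors whose number is the dimension form a basis, and the five vectors of an
  attained quintuple always span \<open>V\<close>.
\<close>

lemma isomorphic_to_table:
  assumes h: "attained p11 p12 p22 m1 m2" and "value_space = vecs V" and "cdim V = length vs"
    and "n = 3 + length vs" and "N1_table n T" and "set vs \<subseteq> {p11, p12, p22, m1, m2}"
    and p: "comb 4 vs (entry T 1 1) = p11" "comb 4 vs (entry T 1 2) = p12"
      "comb 4 vs (entry T 2 2) = p22" "comb 4 vs (entry T 1 3) = m1" "comb 4 vs (entry T 2 3) = m2"
  shows "isomorphic_alg B (table_alg n T)"
proof -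
  have "span (set vs) = vecs V"
    using attained_span_basis[OF h assms(6)] comb_in_span assms(2)
    unfolding p[symmetric] by blast
  moreover from this have "independent (set vs)" "distinct vs"
    using spanning_list_is_basis assms(3) unfolding cdim_def by blast+
  ultimately show ?thesis
    using isomorphic_table_alg[OF h assms(5,4) _ _ _ p] by blast
qed

lemma N1_tables_1:
  assumes "value_space = vecs V" and "cdim V = 1" and normal: "normal1 z"
  shows "\<exists>T\<in>N1_tables_1. isomorphic_alg B (table_alg 4 T)"
  using normal unfolding normal1_def
proof (elim disjE)
  assume h: "attained 0 0 z z 0"
  show ?thesis
    unfolding N1_tables_1_def
    by (rule bexI[rotated, of "[(1,2,e 3), (1,3,e 4), (2,1,- e 3), (2,2,e 4)]"],
        (rule insertI1 | rule insertI2)+, rule isomorphic_to_table[OF h assms(1), of "[z]"])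
      (auto simp: assms(2) N1_table_def entry_def e_apply)
next
  assume h: "attained 0 0 0 z 0"
  show ?thesis
    unfolding N1_tables_1_def
    by (rule bexI[rotated, of "[(1,2,e 3), (1,3,e 4), (2,1,- e 3)]"],
        (rule insertI1 | rule insertI2)+, rule isomorphic_to_table[OF h assms(1), of "[z]"])
      (auto simp: assms(2) N1_table_def entry_def e_apply)
qed

lemma N1_tables_2:
  assumes "value_space = vecs V" and "cdim V = 2" and normal: "normal2 x z"
  shows "\<exists>T\<in>N1_tables_2. isomorphic_alg B (table_alg 5 T)"
  using normal unfolding normal2_def
proof (elim disjE)
  assume h: "attained x 0 0 z 0"
  show ?thesis
    unfolding N1_tables_2_def
    by (rule bexI[rotated, of "[(1,1,e 4), (1,2,e 3), (1,3,e 5), (2,1,- e 3)]"],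
        (rule insertI1 | rule insertI2)+, rule isomorphic_to_table[OF h assms(1), of "[x, z]"])
      (auto simp: assms(2) N1_table_def entry_def e_apply)
next
  assume h: "attained 0 x 0 z 0"
  show ?thesis
    unfolding N1_tables_2_def
    by (rule bexI[rotated, of "[(1,2,e 3 + e 4), (1,3,e 5), (2,1,- e 3)]"],
        (rule insertI1 | rule insertI2)+, rule isomorphic_to_table[OF h assms(1), of "[x, z]"])
      (auto simp: assms(2) N1_table_def entry_def e_apply)
next
  assume h: "attained 0 0 x z 0"
  show ?thesis
    unfolding N1_tables_2_def
    by (rule bexI[rotated, of "[(1,2,e 3), (2,1,- e 3), (1,3,e 5), (2,2,e 4)]"],
        (rule insertI1 | rule insertI2)+, rule isomorphic_to_table[OF h assms(1), of "[x, z]"])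
      (auto simp: assms(2) N1_table_def entry_def e_apply)
next
  assume h: "attained x 0 x z 0"
  show ?thesis
    unfolding N1_tables_2_def
    by (rule bexI[rotated, of "[(1,1,e 4), (1,2,e 3), (1,3,e 5), (2,1,- e 3), (2,2,e 4)]"],
        (rule insertI1 | rule insertI2)+, rule isomorphic_to_table[OF h assms(1), of "[x, z]"])
      (auto simp: assms(2) N1_table_def entry_def e_apply)
next
  assume h: "attained 0 0 0 z x"
  show ?thesis
    unfolding N1_tables_2_def
    by (rule bexI[rotated, of "[(1,2,e 3), (1,3,e 5), (2,1,- e 3), (2,3,e 4)]"],
        (rule insertI1 | rule insertI2)+, rule isomorphic_to_table[OF h assms(1), of "[x, z]"])
      (auto simp: assms(2) N1_table_def entry_def e_apply)
next
  assume h: "attained x 0 0 z x"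
  show ?thesis
    unfolding N1_tables_2_def
    by (rule bexI[rotated, of "[(1,1,e 4), (1,2,e 3), (1,3,e 5), (2,1,- e 3), (2,3,e 4)]"],
        (rule insertI1 | rule insertI2)+, rule isomorphic_to_table[OF h assms(1), of "[x, z]"])
      (auto simp: assms(2) N1_table_def entry_def e_apply)
next
  assume h: "attained 0 x 0 z x"
  show ?thesis
    unfolding N1_tables_2_def
    by (rule bexI[rotated, of "[(1,2,e 3 + e 4), (1,3,e 5), (2,1,- e 3), (2,3,e 4)]"],
        (rule insertI1 | rule insertI2)+, rule isomorphic_to_table[OF h assms(1), of "[x, z]"])
      (auto simp: assms(2) N1_table_def entry_def e_apply)
next
  assume h: "attained x 0 x z x"
  show ?thesis
    unfolding N1_tables_2_def
    by (rule bexI[rotated, of "[(1,1,e 4), (1,2,e 3), (1,3,e 5), (2,1,- e 3), (2,2,e 4), (2,3,e 4)]"],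
        (rule insertI1 | rule insertI2)+, rule isomorphic_to_table[OF h assms(1), of "[x, z]"])
      (auto simp: assms(2) N1_table_def entry_def e_apply)
next
  assume h: "attained x 0 z z 0"
  show ?thesis
    unfolding N1_tables_2_def
    by (rule bexI[rotated, of "[(1,1,e 4), (1,2,e 3), (1,3,e 5), (2,1,- e 3), (2,2,e 5)]"],
        (rule insertI1 | rule insertI2)+, rule isomorphic_to_table[OF h assms(1), of "[x, z]"])
      (auto simp: assms(2) N1_table_def entry_def e_apply)
next
  assume h: "attained 0 x z z 0"
  show ?thesis
    unfolding N1_tables_2_def
    by (rule bexI[rotated, of "[(1,2,e 3 + e 4), (1,3,e 5), (2,1,- e 3), (2,2,e 5)]"],
        (rule insertI1 | rule insertI2)+, rule isomorphic_to_table[OF h assms(1), of "[x, z]"])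
      (auto simp: assms(2) N1_table_def entry_def e_apply)
qed

lemma N1_tables_3:
  assumes "value_space = vecs V" and "cdim V = 3" and normal: "normal3 x y z"
  shows "\<exists>T\<in>N1_tables_3. isomorphic_alg B (table_alg 6 T)"
  using normal unfolding normal3_def
proof (elim disjE)
  assume h: "attained y x 0 z 0"
  show ?thesis
    unfolding N1_tables_3_def
    by (rule bexI[rotated, of "[(1,1,e 5), (1,2,e 3 + e 4), (1,3,e 6), (2,1,- e 3)]"],
        (rule insertI1 | rule insertI2)+, rule isomorphic_to_table[OF h assms(1), of "[x, y, z]"])
      (auto simp: assms(2) N1_table_def entry_def e_apply)
next
  assume h: "attained y 0 x z 0"
  show ?thesis
    unfolding N1_tables_3_def
    by (rule bexI[rotated, of "[(1,1,e 5), (1,2,e 3), (1,3,e 6), (2,1,- e 3), (2,2,e 4)]"],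
        (rule insertI1 | rule insertI2)+, rule isomorphic_to_table[OF h assms(1), of "[x, y, z]"])
      (auto simp: assms(2) N1_table_def entry_def e_apply)
next
  assume h: "attained y 0 0 z x"
  show ?thesis
    unfolding N1_tables_3_def
    by (rule bexI[rotated, of "[(1,1,e 5), (1,2,e 3), (1,3,e 6), (2,1,- e 3), (2,3,e 4)]"],
        (rule insertI1 | rule insertI2)+, rule isomorphic_to_table[OF h assms(1), of "[x, y, z]"])
      (auto simp: assms(2) N1_table_def entry_def e_apply)
next
  assume h: "attained y 0 x z x"
  show ?thesis
    unfolding N1_tables_3_def
    by (rule bexI[rotated, of "[(1,1,e 5), (1,2,e 3), (1,3,e 6), (2,1,- e 3), (2,2,e 4), (2,3,e 4)]"],
        (rule insertI1 | rule insertI2)+, rule isomorphic_to_table[OF h assms(1), of "[x, y, z]"])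
      (auto simp: assms(2) N1_table_def entry_def e_apply)
next
  assume h: "attained 0 y x z 0"
  show ?thesis
    unfolding N1_tables_3_def
    by (rule bexI[rotated, of "[(1,2,e 3 + e 5), (1,3,e 6), (2,1,- e 3), (2,2,e 4)]"],
        (rule insertI1 | rule insertI2)+, rule isomorphic_to_table[OF h assms(1), of "[x, y, z]"])
      (auto simp: assms(2) N1_table_def entry_def e_apply)
next
  assume h: "attained x y x z 0"
  show ?thesis
    unfolding N1_tables_3_def
    by (rule bexI[rotated, of "[(1,1,e 4), (1,2,e 3 + e 5), (1,3,e 6), (2,1,- e 3), (2,2,e 4)]"],
        (rule insertI1 | rule insertI2)+, rule isomorphic_to_table[OF h assms(1), of "[x, y, z]"])
      (auto simp: assms(2) N1_table_def entry_def e_apply)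
next
  assume h: "attained 0 y 0 z x"
  show ?thesis
    unfolding N1_tables_3_def
    by (rule bexI[rotated, of "[(1,2,e 3 + e 5), (1,3,e 6), (2,1,- e 3), (2,3,e 4)]"],
        (rule insertI1 | rule insertI2)+, rule isomorphic_to_table[OF h assms(1), of "[x, y, z]"])
      (auto simp: assms(2) N1_table_def entry_def e_apply)
next
  assume h: "attained x y 0 z x"
  show ?thesis
    unfolding N1_tables_3_def
    by (rule bexI[rotated, of "[(1,1,e 4), (1,2,e 3 + e 5), (1,3,e 6), (2,1,- e 3), (2,3,e 4)]"],
        (rule insertI1 | rule insertI2)+, rule isomorphic_to_table[OF h assms(1), of "[x, y, z]"])
      (auto simp: assms(2) N1_table_def entry_def e_apply)
next
  assume h: "attained x 0 y z x"
  show ?thesis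
    unfolding N1_tables_3_def
    by (rule bexI[rotated, of "[(1,1,e 4), (1,2,e 3), (1,3,e 6), (2,1,- e 3), (2,2,e 5), (2,3,e 4)]"],
        (rule insertI1 | rule insertI2)+, rule isomorphic_to_table[OF h assms(1), of "[x, y, z]"])
      (auto simp: assms(2) N1_table_def entry_def e_apply)
next
  assume h: "attained (x + y) 0 y z x"
  show ?thesis
    unfolding N1_tables_3_def
    by (rule bexI[rotated, of "[(1,1,e 4 + e 5), (1,2,e 3), (1,3,e 6), (2,1,- e 3), (2,2,e 5), (2,3,e 4)]"],
        (rule insertI1 | rule insertI2)+, rule isomorphic_to_table[OF h assms(1), of "[x, y, z]"])
      (auto simp: assms(2) N1_table_def entry_def e_apply)
next
  assume h: "attained y x z z 0"
  show ?thesis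
    unfolding N1_tables_3_def
    by (rule bexI[rotated, of "[(1,1,e 5), (1,2,e 3 + e 4), (1,3,e 6), (2,1,- e 3), (2,2,e 6)]"],
        (rule insertI1 | rule insertI2)+, rule isomorphic_to_table[OF h assms(1), of "[x, y, z]"])
      (auto simp: assms(2) N1_table_def entry_def e_apply)
qed

lemma N1_tables_4:
  assumes "value_space = vecs V" and "cdim V = 4" and normal: "normal4 x y u z"
  shows "\<exists>T\<in>N1_tables_4. isomorphic_alg B (table_alg 7 T)"
  using normal unfolding normal4_def
proof (elim disjE)
  assume h: "attained u y x z 0"
  show ?thesis
    unfolding N1_tables_4_def
    by (rule bexI[rotated, of "[(1,1,e 6), (1,2,e 3 + e 5), (1,3,e 7), (2,1,- e 3), (2,2,e 4)]"],
        (rule insertI1 | rule insertI2)+, rule isomorphic_to_table[OF h assms(1), of "[x, y, u, z]"])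
      (auto simp: assms(2) N1_table_def entry_def e_apply)
next
  assume h: "attained u y 0 z x"
  show ?thesis
    unfolding N1_tables_4_def
    by (rule bexI[rotated, of "[(1,1,e 6), (1,2,e 3 + e 5), (1,3,e 7), (2,1,- e 3), (2,3,e 4)]"],
        (rule insertI1 | rule insertI2)+, rule isomorphic_to_table[OF h assms(1), of "[x, y, u, z]"])
      (auto simp: assms(2) N1_table_def entry_def e_apply)
next
  assume h: "attained u 0 y z x"
  show ?thesis
    unfolding N1_tables_4_def
    by (rule bexI[rotated, of "[(1,1,e 6), (1,2,e 3), (1,3,e 7), (2,1,- e 3), (2,2,e 5), (2,3,e 4)]"],
        (rule insertI1 | rule insertI2)+, rule isomorphic_to_table[OF h assms(1), of "[x, y, u, z]"])
      (auto simp: assms(2) N1_table_def entry_def e_apply)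
next
  assume h: "attained x u y z x"
  show ?thesis
    unfolding N1_tables_4_def
    by (rule bexI[rotated, of "[(1,1,e 4), (1,2,e 3 + e 6), (1,3,e 7), (2,1,- e 3), (2,2,e 5), (2,3,e 4)]"],
        (rule insertI1 | rule insertI2)+, rule isomorphic_to_table[OF h assms(1), of "[x, y, u, z]"])
      (auto simp: assms(2) N1_table_def entry_def e_apply)
qed

lemma N1_tables_5:
  assumes "value_space = vecs V" and "cdim V = 5" and h: "attained x y u z w"
  shows "\<exists>T\<in>N1_tables_5. isomorphic_alg B (table_alg 8 T)"
  unfolding N1_tables_5_def
  by (rule bexI[rotated, of "[(1,1,e 4), (1,2,e 3 + e 5), (1,3,e 7), (2,1,- e 3), (2,2,e 6), (2,3,e 8)]"],
        (rule insertI1 | rule insertI2)+, rule isomorphic_to_table[OF h assms(1), of "[x, y, u, z, w]"])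
      (auto simp: assms(2) N1_table_def entry_def e_apply)

end

theorem theorem13:
  fixes V :: "'v::ab_group_add cspace"
    and \<theta> :: "(nat \<Rightarrow> complex) \<Rightarrow> (nat \<Rightarrow> complex) \<Rightarrow> 'v"
    and i :: "nat"
  assumes "fd_space V" and "cdim V = i" and "i \<ge> 1"
    and "\<theta> \<in> cocycles N1 V"
    and "nontrivial_ext N1 V \<theta>"
  shows "(i = 1 \<and> (\<exists>T\<in>N1_tables_1. isomorphic_alg (central_ext N1 V \<theta>) (table_alg 4 T))) \<or>
         (i = 2 \<and> (\<exists>T\<in>N1_tables_2. isomorphic_alg (central_ext N1 V \<theta>) (table_alg 5 T))) \<or>
         (i = 3 \<and> (\<exists>T\<in>N1_tables_3. isomorphic_alg (central_ext N1 V \<theta>) (table_alg 6 T))) \<or>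
         (i = 4 \<and> (\<exists>T\<in>N1_tables_4. isomorphic_alg (central_ext N1 V \<theta>) (table_alg 7 T))) \<or>
         (i = 5 \<and> (\<exists>T\<in>N1_tables_5. isomorphic_alg (central_ext N1 V \<theta>) (table_alg 8 T)))"
proof -
  interpret N1_extension V \<theta>
    using assms(1,4) by unfold_locales
  have spans: "value_space = vecs V"
    using assms(5) by (intro non_split_spans) (simp add: nontrivial_ext_def)
  have i: "dim value_space = i"
    using assms(2) unfolding spans cdim_def .
  have "\<theta> (e 1) (e 3) \<noteq> 0 \<or> \<theta> (e 2) (e 3) \<noteq> 0"
    using assms(5) by (intro linear_part_nonzero) (simp add: nontrivial_ext_def)
  then have classified by (rule classification)
  then show ?thesis
    unfolding classified_def i
    apply (elim disjE conjE exE)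
    subgoal using N1_tables_1[OF spans] assms(2) by simp
    subgoal using N1_tables_2[OF spans] assms(2) by simp
    subgoal using N1_tables_3[OF spans] assms(2) by simp
    subgoal using N1_tables_4[OF spans] assms(2) by simp
    subgoal using N1_tables_5[OF spans] assms(2) by simp
    done
qed

end
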